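(* Let $\alpha>-1$. For $N\ge1$ let $z_{N,N}^{(\alpha)}$ be the largest zero of the Laguerre polynomial $L_N^{(\alpha)}$ and define $$f_N(y):=N^{1/6}\sqrt{z_{N,N}^{(\alpha)}}\;Q^{(\alpha)}_{\lfloor N^{1/3}y\rfloor,N}\bigl(z_{N,N}^{(\alpha)}\bigr)\quad\text{for } y\in[0,N^{2/3}[,$$ and $f_N(y):=0$ otherwise. Then, as $N\to\infty$, $(f_N)_{N\ge1}$ converges locally uniformly on $[0,\infty[$ to $$f(y)=\frac{2^{1/3}\,\mathsf{Ai}(2^{2/3}y+a_1)}{\mathsf{Ai}'(a_1)}\qquad(y\in[0,\infty[),$$ where $\mathsf{Ai}$ is the Airy function and $a_1=-2.338\ldots$ its largest zero.
   Context: Let $z_{1,N}^{(\alpha)}<\dots<z_{N,N}^{(\alpha)}$ be the zeros of the Laguerre polynomial $L_N^{(\alpha)}$ (orthogonal with respect to $e^{-x}x^\alpha$ on $]0,\infty[$). $(Q_{k,N}^{(\alpha)})_{k=0,\dots,N-1}$ are the polynomials with $\deg Q_{k,N}^{(\alpha)}=k$, positive leading coefficients, and $\sum_{i=1}^N z_{i,N}^{(\alpha)}Q_{k,N}^{(\alpha)}(z_{i,N}^{(\alpha)})Q_{l,N}^{(\alpha)}(z_{i,N}^{(\alpha)})=\delta_{k,l}$. Equivalently, they satisfy $xQ_{k,N}^{(\alpha)}(x)=\sqrt{(N-k)(N-k+\alpha)}\,Q_{k-1,N}^{(\alpha)}(x)+(2(N-k)+\alpha-1)Q_{k,N}^{(\alpha)}(x)+\sqrt{(N-k-1)(N-k-1+\alpha)}\,Q_{k+1,N}^{(\alpha)}(x)$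 for $0\le k\le N-2$, with $Q_{-1,N}^{(\alpha)}=0$ and $Q_{0,N}^{(\alpha)}=\frac1{\sqrt{N(N+\alpha)}}$. The Airy function $\mathsf{Ai}$ is the solution of $y''(z)=z\,y(z)$ on $\mathbb R$ with $y(z)\to0$ as $z\to\infty$ and $y(0)=\frac1{3^{2/3}\Gamma(2/3)}$. *)

theory Defs
  imports "HOL-Analysis.Analysis"
begin

section \<open>Laguerre polynomials\<close>

text \<open>
  The normalisation is the classical one: leading coefficient $(-1)^N / N!$.
  The lemmas \<open>degree_laguerre\<close> and \<open>laguerre_orthogonal\<close> below show that
  this is the orthogonal polynomial of degree $N$ for the weight $e^{-x} x^\alpha$ on the
  positive half-line.
\<close>

definition laguerre :: "real \<Rightarrow> nat \<Rightarrow> real poly" where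
  "laguerre \<alpha> N =
     (\<Sum>k\<le>N. monom ((-1) ^ k * ((real N + \<alpha>) gchoose (N - k)) / fact k) k)"

lemma coeff_laguerre:
  "coeff (laguerre \<alpha> N) k =
     (if k \<le> N then (-1) ^ k * ((real N + \<alpha>) gchoose (N - k)) / fact k else 0)"
  unfolding laguerre_def by (simp add: coeff_sum)

lemma degree_laguerre: "degree (laguerre \<alpha> N) = N"
proof (rule antisym)
  show "degree (laguerre \<alpha> N) \<le> N"
    by (rule degree_le) (simp add: coeff_laguerre)
  show "N \<le> degree (laguerre \<alpha> N)"
    by (rule le_degree) (simp add: coeff_laguerre)
qed

lemma alternating_sum_pochhammer:
  fixes c :: real
  assumes "j < N"
  shows "(\<Sum>k\<le>N. (-1) ^ k * real (N choose k) * pochhammer (c + real k) j) = 0"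
  using assms
proof (induction N arbitrary: j c)
  case 0
  then show ?case by simp
next
  case (Suc N)
  define g where "g = (\<lambda>k. pochhammer (c + real k) j)"
  have "(\<Sum>k\<le>Suc N. (-1) ^ k * real (Suc N choose k) * g k) =
      g 0 + (\<Sum>k\<le>N. (-1) ^ Suc k * (real (N choose k) + real (N choose Suc k)) * g (Suc k))"
    by (subst sum.atMost_Suc_shift) simp
  also have "\<dots> = (g 0 + (\<Sum>k\<le>N. (-1) ^ Suc k * real (N choose Suc k) * g (Suc k)))
      - (\<Sum>k\<le>N. (-1) ^ k * real (N choose k) * g (Suc k))"
    by (simp add: sum.distrib sum_negf sum_subtractf algebra_simps)
  also have "g 0 + (\<Sum>k\<le>N. (-1) ^ Suc k * real (N choose Suc k) * g (Suc k)) =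
      (\<Sum>k\<le>Suc N. (-1) ^ k * real (N choose k) * g k)"
    by (subst sum.atMost_Suc_shift) simp
  also have "\<dots> = (\<Sum>k\<le>N. (-1) ^ k * real (N choose k) * g k)"
    by simp
  also have "\<dots> - (\<Sum>k\<le>N. (-1) ^ k * real (N choose k) * g (Suc k)) =
      (\<Sum>k\<le>N. (-1) ^ k * real (N choose k) * (g k - g (Suc k)))"
    by (simp add: sum_subtractf right_diff_distrib)
  also have "\<dots> = 0"
  proof (cases j)
    case 0
    then show ?thesis by (simp add: g_def)
  next
    case (Suc i)
    have *: "g k - g (Suc k) = - real j * pochhammer (c + 1 + real k) i" for k
    proof -
      have "g k = (c + real k) * pochhammer (c + 1 + real k) i"
        by (simp add: g_def Suc pochhammer_rec add_ac)
      moreover have "g (Suc k) = pochhammer (c + 1 + real k) i * (c + 1 + real k + real i)"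
        by (simp add: g_def Suc pochhammer_rec' add_ac mult_ac)
      ultimately show ?thesis by (simp add: Suc algebra_simps)
    qed
    have "(\<Sum>k\<le>N. (-1) ^ k * real (N choose k) * (g k - g (Suc k))) =
        - real j * (\<Sum>k\<le>N. (-1) ^ k * real (N choose k) * pochhammer (c + 1 + real k) i)"
      unfolding * sum_distrib_left by (intro sum.cong) auto
    also have "\<dots> = 0"
      using Suc.IH[of i "c + 1"] Suc.prems Suc by simp
    finally show ?thesis .
  qed
  finally show ?case by (simp add: g_def)
qed

lemma laguerre_orthogonal:
  assumes \<alpha>: "\<alpha> > -1" and p: "degree p < N"
  shows "((\<lambda>x. exp (-x) * x powr \<alpha> * poly (laguerre \<alpha> N) x * poly p x)
           has_integral 0) {0<..}"
proof -
  have mono: "((\<lambda>x. exp (-x) * x powr \<alpha> * x ^ n) has_integral Gamma (\<alpha> + 1 + real n)) {0<..}"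
    for n
  proof -
    have "((\<lambda>t. t powr (\<alpha> + 1 + real n - 1) / exp t) has_integral Gamma (\<alpha> + 1 + real n)) {0<..}"
    proof -
      have "((\<lambda>t. t powr (\<alpha> + 1 + real n - 1) / exp t) has_integral Gamma (\<alpha> + 1 + real n)) {0..}"
        by (rule Gamma_integral_real) (use \<alpha> in linarith)
      moreover have "negligible {x \<in> {0::real..} - {0<..}. x powr (\<alpha> + 1 + real n - 1) / exp x \<noteq> 0}"
        by (rule negligible_subset[OF negligible_sing[of 0]]) force
      moreover have "negligible {x \<in> {0::real<..} - {0..}. x powr (\<alpha> + 1 + real n - 1) / exp x \<noteq> 0}"
        by (rule negligible_subset[OF negligible_sing[of 0]]) force
      ultimately show ?thesis
        by (rule has_integral_spike_set_eq[THEN iffD1, rotated 2])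
    qed
    then show ?thesis
    proof (rule has_integral_eq[rotated])
      fix x :: real
      assume "x \<in> {0<..}"
      then have "x powr (\<alpha> + 1 + real n - 1) = x powr \<alpha> * x ^ n"
        by (simp add: powr_add powr_realpow)
      then show "x powr (\<alpha> + 1 + real n - 1) / exp x = exp (-x) * x powr \<alpha> * x ^ n"
        by (simp add: exp_minus divide_inverse mult_ac)
    qed
  qed
  have zero: "(\<Sum>k\<le>N. coeff (laguerre \<alpha> N) k * Gamma (\<alpha> + 1 + real (k + j))) = 0"
    if "j < N" for j
  proof -
    have "coeff (laguerre \<alpha> N) k * Gamma (\<alpha> + 1 + real (k + j)) =
        Gamma (real N + \<alpha> + 1) / fact N *
          ((-1) ^ k * real (N choose k) * pochhammer (\<alpha> + 1 + real k) j)" if "k \<le> N" for k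
    proof -
      have pos: "\<alpha> + 1 + real k > 0" "real N + \<alpha> + 1 > 0"
        using \<alpha> by linarith+
      then have nz: "\<alpha> + 1 + real k \<notin> \<int>\<^sub>\<le>\<^sub>0" "real N + \<alpha> + 1 \<notin> \<int>\<^sub>\<le>\<^sub>0"
        by (auto elim!: nonpos_Ints_cases)
      have "Gamma (\<alpha> + 1 + real (k + j)) = Gamma (\<alpha> + 1 + real k) * pochhammer (\<alpha> + 1 + real k) j"
        using pochhammer_Gamma[OF nz(1), of j] Gamma_real_pos[OF pos(1)]
        by (simp add: field_simps)
      moreover have "(real N + \<alpha>) gchoose (N - k) =
          Gamma (real N + \<alpha> + 1) / (fact (N - k) * Gamma (\<alpha> + 1 + real k))"
        using gbinomial_Gamma[OF nz(2), of "N - k"] that by (simp add: of_nat_diff algebra_simps)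
      moreover have "real (N choose k) = fact N / (fact k * fact (N - k))"
        using that by (rule binomial_fact)
      moreover have "coeff (laguerre \<alpha> N) k =
          (-1) ^ k * ((real N + \<alpha>) gchoose (N - k)) / fact k"
        using that by (simp add: coeff_laguerre)
      moreover have "Gamma (\<alpha> + 1 + real k) \<noteq> 0"
        using Gamma_real_pos[OF pos(1)] by simp
      ultimately show ?thesis
        by (simp only:) (simp add: mult_ac)
    qed
    then have "(\<Sum>k\<le>N. coeff (laguerre \<alpha> N) k * Gamma (\<alpha> + 1 + real (k + j))) =
        Gamma (real N + \<alpha> + 1) / fact N *
          (\<Sum>k\<le>N. (-1) ^ k * real (N choose k) * pochhammer (\<alpha> + 1 + real k) j)"
      unfolding sum_distrib_left by (intro sum.cong) auto
    then show ?thesis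
      using alternating_sum_pochhammer[OF that] by simp
  qed
  have "((\<lambda>x. \<Sum>j\<le>degree p. \<Sum>k\<le>N. coeff p j *
            (coeff (laguerre \<alpha> N) k * (exp (-x) * x powr \<alpha> * x ^ (k + j))))
          has_integral (\<Sum>j\<le>degree p. \<Sum>k\<le>N. coeff p j *
            (coeff (laguerre \<alpha> N) k * Gamma (\<alpha> + 1 + real (k + j))))) {0<..}"
    by (intro has_integral_sum has_integral_mult_right mono) auto
  moreover have "(\<Sum>j\<le>degree p. \<Sum>k\<le>N. coeff p j *
            (coeff (laguerre \<alpha> N) k * Gamma (\<alpha> + 1 + real (k + j)))) = 0"
    using zero p by (simp flip: sum_distrib_left)
  moreover have "(\<Sum>j\<le>degree p. \<Sum>k\<le>N. coeff p j *
            (coeff (laguerre \<alpha> N) k * (exp (-x) * x powr \<alpha> * x ^ (k + j)))) =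
          exp (-x) * x powr \<alpha> * poly (laguerre \<alpha> N) x * poly p x" for x
    unfolding poly_altdef[of p] poly_altdef[of "laguerre \<alpha> N"] degree_laguerre
    by (subst sum.swap) (simp add: sum_distrib_left sum_distrib_right power_add mult_ac)
  ultimately show ?thesis by simp
qed

definition laguerre_zeros :: "real \<Rightarrow> nat \<Rightarrow> real set" where
  "laguerre_zeros \<alpha> N = {x. poly (laguerre \<alpha> N) x = 0}"

definition largest_laguerre_zero :: "real \<Rightarrow> nat \<Rightarrow> real" where
  "largest_laguerre_zero \<alpha> N = Max (laguerre_zeros \<alpha> N)"


section \<open>The dual polynomials\<close>

definition is_dual_laguerre :: "real \<Rightarrow> nat \<Rightarrow> (nat \<Rightarrow> real poly) \<Rightarrow> bool" where
  "is_dual_laguerre \<alpha> N Q \<longleftrightarrow>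
     (\<forall>k<N. degree (Q k) = k \<and> lead_coeff (Q k) > 0) \<and>
     (\<forall>k<N. \<forall>l<N. (\<Sum>z\<in>laguerre_zeros \<alpha> N. z * poly (Q k) z * poly (Q l) z)
                     = (if k = l then 1 else 0))"

text \<open>
  \<open>is_dual_laguerre\<close> determines $Q_k$ only for $k < N$; the other members of the
  family are arbitrary and must not be used.
\<close>

definition dual_laguerre :: "real \<Rightarrow> nat \<Rightarrow> nat \<Rightarrow> real poly" where
  "dual_laguerre \<alpha> N = (SOME Q. is_dual_laguerre \<alpha> N Q)"


section \<open>The Airy function\<close>

definition is_airy :: "(real \<Rightarrow> real) \<Rightarrow> bool" where
  "is_airy y \<longleftrightarrow>
     (\<forall>z. y differentiable at z \<and> (deriv y has_real_derivative z * y z) (at z)) \<and>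
     (y \<longlongrightarrow> 0) at_top \<and>
     y 0 = 1 / (3 powr (2/3) * Gamma (2/3))"

definition airy_Ai :: "real \<Rightarrow> real" where
  "airy_Ai = (THE y. is_airy y)"

definition airy_a1 :: real where
  "airy_a1 = (GREATEST z. airy_Ai z = 0)"

end

theory Submission
  imports Defs
    "HOL-Computational_Algebra.Fundamental_Theorem_Algebra"
    "HOL-Real_Asymp.Real_Asymp"
begin

text \<open>
  At a zero \<open>z\<close> of \<open>L\<^sub>N\<close> the dual polynomials are the orthonormal Laguerre polynomials in reverse order,
  normalised by the Christoffel-Darboux formula, so \<open>sqrt z * Q\<^sub>k(z)\<close> is the normalised eigenvector of the
  Jacobi matrix. For the largest zero this eigenvector is positive, and its three-term recurrence, written with
  \<open>z = 4 N - \<mu>\<^sub>N N\<^bsup>1/3\<^esup>\<close> and step \<open>N\<^bsup>-1/3\<^esup>\<close>, is an Euler scheme for the initial value problem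
  \<open>G'' = (4 y - \<mu>) G\<close>, \<open>G 0 = 0\<close>, \<open>G' 0 = 2\<close>.

  The sequence \<open>\<mu>\<^sub>N\<close> is bounded, from below by a row-sum argument and from above by Sturm comparison with a
  discrete sine. Along any subsequence with \<open>\<mu>\<^sub>N \<longlonglongrightarrow> m\<close> the limit \<open>G\<close> is nonnegative, and it is eventually
  nonincreasing because the eigenvector decreases once the recurrence is dominated by its diagonal. Hence \<open>G\<close>
  decays, so it is a shifted and rescaled multiple of \<open>Ai\<close> that vanishes at \<open>y = 0\<close> and nowhere to the right. This also shows
  that \<open>Ai\<close> and \<open>a\<^sub>1\<close> exist, and it forces \<open>m = - 2\<^bsup>4/3\<^esup> a\<^sub>1\<close>, so the full sequence converges.
\<close>

section \<open>Laguerre polynomials and their zeros\<close>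

text \<open>No asymptotics of the largest zero z are available in advance, and
  \<open>airy_Ai\<close> and \<open>airy_a1\<close> are bare descriptions that carry no facts until
  a decaying solution is exhibited. The eigenvector supplies both. Convergence on bounded intervals
  cannot give decay at infinity, so two properties that survive the limit take its place: positivity
  and monotonicity beyond a fixed y. Constants: put t = N^(1/3), b_n =
  \<open>jac_b \<alpha> n\<close>, V = \<open>top_vec \<alpha> N\<close>. Written with second
  differences, the eigenvalue equation is b_(N-j-1) (V_(j+2) - 2 V_(j+1) + V_j) = (z - row sum)
  V_(j+1) + (b_(N-j) - b_(N-j-1)) (V_(j+1) - V_j). The row sum is 4 N - 4 j up to a bounded error,
  so the first coefficient is about 4 j - \<mu> t. Dividing by b of size t^3 and by the squared step
  t^(-2) turns it into 4 y - \<mu> at y = j / t, and the first-difference term becomes negligible.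
  The initial slope 2 comes from V_1 = sqrt z / b_N, about 2 N^(-1/2), multiplied by N^(1/6) and
  divided by the step N^(-1/3).\<close>

definition jac_b :: "real \<Rightarrow> nat \<Rightarrow> real" where
  "jac_b \<alpha> n = sqrt (real n * (real n + \<alpha>))"

lemma jac_b_0 [simp]: "jac_b \<alpha> 0 = 0"
  by (simp add: jac_b_def)

text \<open>\<open>jac_b\<close> is the off-diagonal entry of the Laguerre Jacobi matrix. For n at
  least 1, \<alpha> > -1 makes both factors under the root positive.\<close>

lemma jac_b_pos: "\<alpha> > -1 \<Longrightarrow> n > 0 \<Longrightarrow> jac_b \<alpha> n > 0"
  by (cases n) (auto simp: jac_b_def)

lemma jac_b_nonneg: "\<alpha> > -1 \<Longrightarrow> jac_b \<alpha> n \<ge> 0"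
  using jac_b_pos[of \<alpha> n] by (cases "n = 0") auto

lemma jac_b_square: "\<alpha> > -1 \<Longrightarrow> jac_b \<alpha> n ^ 2 = real n * (real n + \<alpha>)"
  by (cases n) (auto simp: jac_b_def)

section \<open>Coefficient identities and the three-term recurrence\<close>

lemma gbinomial_diff_absorb:
  assumes "k \<le> n"
  shows "(real (Suc n) + \<alpha>) * ((real n + \<alpha>) gchoose (n - k)) =
    real (Suc n - k) * ((real (Suc n) + \<alpha>) gchoose (Suc n - k))"
  using gbinomial_absorption[of "n - k" "real (Suc n) + \<alpha>"] assms
  by (simp add: Suc_diff_le algebra_simps)

text \<open>Coefficient form of x L_(n+1)' = (n+1) L_(n+1) - (n+1+\<alpha>) L_n, which is how
  \<open>laguerre_pderiv\<close> reads it.\<close>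

lemma coeff_laguerre_diff:
  "(real (Suc n) + \<alpha>) * coeff (laguerre \<alpha> n) k = (real (Suc n) - real k) * coeff (laguerre \<alpha> (Suc n)) k"
proof (cases "k \<le> n")
  case True
  have "(real (Suc n) + \<alpha>) * coeff (laguerre \<alpha> n) k =
      (-1) ^ k / fact k * ((real (Suc n) + \<alpha>) * ((real n + \<alpha>) gchoose (n - k)))"
    using True by (simp add: coeff_laguerre)
  also have "\<dots> = (real (Suc n) - real k) * coeff (laguerre \<alpha> (Suc n)) k"
    unfolding gbinomial_diff_absorb[OF True] using True by (simp add: coeff_laguerre)
  finally show ?thesis .
qed (auto simp: coeff_laguerre not_le le_Suc_eq)

text \<open>Coefficient form of (n+1) L_(n+1) = x L_n' + (n+1+\<alpha>-x) L_n. Pascal's rule splits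
  the coefficient of L_(n+1) into X + Y, and multiplication by x produces the second summand
  again.\<close>

lemma coeff_laguerre_Suc:
  "(real n + 1) * coeff (laguerre \<alpha> (Suc n)) k = (real n + 1 + \<alpha> + real k) * coeff (laguerre \<alpha> n) k
     - coeff (pCons 0 (laguerre \<alpha> n)) k"
proof (cases "k \<le> n")
  case True
  define S where "S = (-1) ^ k / (fact k :: real)"
  define X where "X = ((real n + \<alpha>) gchoose (n - k))"
  define Y where "Y = ((real n + \<alpha>) gchoose (Suc (n - k)))"
  have Y: "real (Suc (n - k)) * Y = (\<alpha> + real k) * X"
    using gbinomial_mult_1[of "real n + \<alpha>" "n - k"] True
    unfolding X_def Y_def by (simp add: of_nat_diff algebra_simps)
  have c1: "coeff (laguerre \<alpha> (Suc n)) k = S * (X + Y)"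
    using True gbinomial_Suc_Suc[of "real n + \<alpha>" "n - k"]
    by (simp add: coeff_laguerre Suc_diff_le S_def X_def Y_def add_ac)
  have c2: "coeff (laguerre \<alpha> n) k = S * X"
    using True by (simp add: coeff_laguerre S_def X_def)
  have c3: "coeff (pCons 0 (laguerre \<alpha> n)) k = - (S * (real k * Y))"
  proof (cases k)
    case (Suc j)
    then have "n - j = Suc (n - k)" using True by simp
    then show ?thesis using Suc True
      by (simp add: coeff_laguerre S_def Y_def divide_simps del: of_nat_Suc)
  qed simp
  have "(real n + 1) * (X + Y) = (real n + 1 + \<alpha> + real k) * X + real k * Y"
    using Y True by (simp add: of_nat_diff algebra_simps)
  from arg_cong[OF this, of "\<lambda>t. S * t"] show ?thesis
    unfolding c1 c2 c3 by (simp add: algebra_simps)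
next
  case False
  show ?thesis
  proof (cases "k = Suc n")
    case True
    have f: "fact (Suc n) = (real n + 1) * fact n" "real n + 1 \<noteq> 0"
      by (simp_all add: algebra_simps)
    show ?thesis using True f(2)
      by (simp add: coeff_laguerre f(1) del: fact_Suc)
  next
    case False
    with \<open>\<not> k \<le> n\<close> have "k > Suc n" by simp
    then show ?thesis by (cases k) (simp_all add: coeff_laguerre)
  qed
qed

text \<open>Generic in the field: the real instance carries the eigenvector, the complex one the
  proof that all zeros are real.\<close>

abbreviation laguerre_map :: "real \<Rightarrow> nat \<Rightarrow> 'a :: real_field poly" where
  "laguerre_map \<alpha> n \<equiv> map_poly of_real (laguerre \<alpha> n)"

text \<open>The derivative term k times the k-th coefficient of L_(n+1) is eliminated between
  \<open>coeff_laguerre_Suc\<close> at n+1 and \<open>coeff_laguerre_diff\<close> at n.\<close>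

lemma laguerre_map_rec:
  "smult (of_nat (Suc (Suc n))) (laguerre_map \<alpha> (Suc (Suc n)) :: 'a :: real_field poly) =
     [:of_real (2 * real n + 3 + \<alpha>), -1:] * laguerre_map \<alpha> (Suc n)
     - smult (of_real (real (Suc n) + \<alpha>)) (laguerre_map \<alpha> n)"
proof (rule poly_eqI)
  fix k
  let ?c = "coeff (laguerre \<alpha> (Suc n)) k" and ?p = "coeff (pCons 0 (laguerre \<alpha> (Suc n))) k"
  have "real (Suc (Suc n)) * coeff (laguerre \<alpha> (Suc (Suc n))) k =
      (2 * real n + 3 + \<alpha>) * ?c - ?p - (real (Suc n) + \<alpha>) * coeff (laguerre \<alpha> n) k"
    using coeff_laguerre_Suc[of "Suc n" \<alpha> k] coeff_laguerre_diff[of n \<alpha> k]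
    by (simp add: algebra_simps)
  then have "(of_real (real (Suc (Suc n)) * coeff (laguerre \<alpha> (Suc (Suc n))) k) :: 'a) =
      of_real ((2 * real n + 3 + \<alpha>) * ?c - ?p - (real (Suc n) + \<alpha>) * coeff (laguerre \<alpha> n) k)"
    by (rule arg_cong)
  then show "coeff (smult (of_nat (Suc (Suc n))) (laguerre_map \<alpha> (Suc (Suc n)) :: 'a poly)) k =
      coeff ([:of_real (2 * real n + 3 + \<alpha>), -1:] * laguerre_map \<alpha> (Suc n)
       - smult (of_real (real (Suc n) + \<alpha>)) (laguerre_map \<alpha> n)) k"
    by (cases k) (simp_all add: coeff_map_poly coeff_pCons algebra_simps)
qed

lemma laguerre_map_0: "laguerre_map \<alpha> 0 = (1 :: 'a :: real_field poly)"
  by (rule poly_eqI) (simp add: coeff_map_poly coeff_laguerre)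

lemma laguerre_map_1: "laguerre_map \<alpha> (Suc 0) = ([:of_real (1 + \<alpha>), -1:] :: 'a :: real_field poly)"
  by (rule poly_eqI) (auto simp: coeff_map_poly coeff_laguerre coeff_pCons split: nat.splits)

lemma laguerre_pderiv:
  "[:0, 1:] * pderiv (laguerre \<alpha> (Suc n)) =
     smult (real (Suc n)) (laguerre \<alpha> (Suc n)) - smult (real (Suc n) + \<alpha>) (laguerre \<alpha> n)"
proof (rule poly_eqI)
  fix k
  show "coeff ([:0, 1:] * pderiv (laguerre \<alpha> (Suc n))) k =
      coeff (smult (real (Suc n)) (laguerre \<alpha> (Suc n)) - smult (real (Suc n) + \<alpha>) (laguerre \<alpha> n)) k"
    using coeff_laguerre_diff[of n \<alpha> k]
    by (cases k) (simp_all add: coeff_pderiv algebra_simps)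
qed

text \<open>\<open>onl\<close> is the orthonormal Laguerre polynomial with positive leading coefficient, up to
  the factor \<open>sqrt (Gamma (\<alpha> + 1))\<close>, so that \<open>onl \<alpha> 0 = 1\<close>.\<close>

definition lag_weight :: "real \<Rightarrow> nat \<Rightarrow> real" where
  "lag_weight \<alpha> n = sqrt (fact n / pochhammer (\<alpha> + 1) n)"

definition onl :: "real \<Rightarrow> nat \<Rightarrow> 'a :: real_field \<Rightarrow> 'a" where
  "onl \<alpha> n x = of_real ((-1) ^ n * lag_weight \<alpha> n) * poly (laguerre_map \<alpha> n) x"

lemma lag_weight_pos: "\<alpha> > -1 \<Longrightarrow> lag_weight \<alpha> n > 0"
  by (simp add: lag_weight_def pochhammer_pos)

text \<open>This ratio and the next one symmetrise the recurrence: they convert its unequal factors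
  n+1 and n+1+\<alpha> into the same off-diagonal entry.\<close>

lemma lag_weight_Suc1:
  assumes "\<alpha> > -1"
  shows "jac_b \<alpha> (Suc n) * lag_weight \<alpha> (Suc n) = real (Suc n) * lag_weight \<alpha> n"
proof (rule power2_eq_imp_eq)
  define P c where "P = pochhammer (\<alpha> + 1) n" and "c = real (Suc n) + \<alpha>"
  have pos: "P > 0" "c > 0" and Pc: "pochhammer (\<alpha> + 1) (Suc n) = P * c"
    using assms by (auto simp: P_def c_def pochhammer_Suc add_ac intro: pochhammer_pos)
  then have "0 \<le> fact n / P" "0 \<le> fact (Suc n) / (P * c)"
    by auto
  then show "(jac_b \<alpha> (Suc n) * lag_weight \<alpha> (Suc n))\<^sup>2 = (real (Suc n) * lag_weight \<alpha> n)\<^sup>2"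
    unfolding power_mult_distrib jac_b_square[OF assms] lag_weight_def Pc P_def[symmetric] c_def[symmetric]
    using pos by (simp add: field_simps power2_eq_square)
qed (use assms lag_weight_pos[OF assms] jac_b_nonneg[OF assms] in \<open>auto simp: less_imp_le\<close>)

lemma lag_weight_Suc2:
  assumes "\<alpha> > -1"
  shows "jac_b \<alpha> (Suc n) * lag_weight \<alpha> n = (real (Suc n) + \<alpha>) * lag_weight \<alpha> (Suc n)"
proof -
  have "real (Suc n) * (jac_b \<alpha> (Suc n) * lag_weight \<alpha> n) =
      jac_b \<alpha> (Suc n) ^ 2 * lag_weight \<alpha> (Suc n)"
    using lag_weight_Suc1[OF assms, of n] by (simp add: power2_eq_square algebra_simps)
  then show ?thesis
    unfolding jac_b_square[OF assms] by simp
qed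

lemma onl_0 [simp]: "onl \<alpha> 0 x = 1"
  by (simp add: onl_def laguerre_map_0 lag_weight_def)

text \<open>At \<open>n = 0\<close> the truncated index \<open>n - 1\<close> is harmless because \<open>jac_b \<alpha> 0 = 0\<close>.\<close>

lemma onl_rec:
  assumes "\<alpha> > -1"
  shows "of_real (jac_b \<alpha> (Suc n)) * onl \<alpha> (Suc n) x =
    (x - of_real (2 * real n + 1 + \<alpha>)) * onl \<alpha> n x - of_real (jac_b \<alpha> n) * onl \<alpha> (n - 1) x"
proof (cases n)
  case 0
  have "of_real (jac_b \<alpha> (Suc 0)) * onl \<alpha> (Suc 0) x =
      - of_real (jac_b \<alpha> (Suc 0) * lag_weight \<alpha> (Suc 0)) * poly (laguerre_map \<alpha> (Suc 0)) x"
    by (simp add: onl_def)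
  also have "\<dots> = x - of_real (1 + \<alpha>)"
    unfolding lag_weight_Suc1[OF assms] laguerre_map_1 by (simp add: lag_weight_def)
  finally show ?thesis using 0 by simp
next
  case (Suc m)
  let ?L = "\<lambda>n. poly (laguerre_map \<alpha> n) x"
  have L: "of_real (real (Suc (Suc m))) * ?L (Suc (Suc m)) =
      (of_real (2 * real m + 3 + \<alpha>) - x) * ?L (Suc m) - of_real (real (Suc m) + \<alpha>) * ?L m"
    using arg_cong[OF laguerre_map_rec[of m \<alpha>], of "\<lambda>p. poly p x"] by (simp add: algebra_simps)
  have "of_real (jac_b \<alpha> (Suc n)) * onl \<alpha> (Suc n) x =
     of_real ((-1)^m) * (of_real (jac_b \<alpha> (Suc n) * lag_weight \<alpha> (Suc n)) * ?L (Suc n))"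
    by (simp add: onl_def Suc)
  also have "\<dots> = of_real ((-1)^m * lag_weight \<alpha> n) * (of_real (real (Suc (Suc m))) * ?L (Suc (Suc m)))"
    unfolding lag_weight_Suc1[OF assms] by (simp add: Suc mult_ac)
  also have "\<dots> = (x - of_real (2 * real n + 1 + \<alpha>)) * onl \<alpha> n x
      - of_real ((-1)^m) * (of_real ((real (Suc m) + \<alpha>) * lag_weight \<alpha> (Suc m)) * ?L m)"
    unfolding L by (simp add: onl_def Suc algebra_simps)
  also have "\<dots> = (x - of_real (2 * real n + 1 + \<alpha>)) * onl \<alpha> n x - of_real (jac_b \<alpha> n) * onl \<alpha> (n - 1) x"
    unfolding lag_weight_Suc2[OF assms, symmetric] by (simp add: Suc onl_def)
  finally show ?thesis .
qed

lemma onl_real: "onl \<alpha> n x = (-1) ^ n * lag_weight \<alpha> n * poly (laguerre \<alpha> n) (x :: real)"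
proof -
  have "map_poly of_real (laguerre \<alpha> n) = laguerre \<alpha> n"
    by (rule poly_eqI) (simp add: coeff_map_poly)
  then show ?thesis by (simp add: onl_def)
qed

text \<open>Telescoping: the recurrences make the increment of the right-hand side equal to (x - y)
  u_N v_N. The sum is bilinear, without conjugation, so v may be taken at the conjugate
  point.\<close>

lemma christoffel_darboux:
  fixes u v :: "nat \<Rightarrow> 'a :: comm_ring_1"
  assumes "\<And>n. b (Suc n) * u (Suc n) = (x - a n) * u n - b n * u (n - 1)"
    and "\<And>n. b (Suc n) * v (Suc n) = (y - a n) * v n - b n * v (n - 1)"
    and "b 0 = 0"
  shows "(x - y) * (\<Sum>n<N. u n * v n) = b N * (u N * v (N - 1) - u (N - 1) * v N)"
proof (induction N)
  case (Suc N)
  have "b (Suc N) * (u (Suc N) * v N - u N * v (Suc N)) =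
      (b (Suc N) * u (Suc N)) * v N - u N * (b (Suc N) * v (Suc N))"
    by (simp add: algebra_simps)
  also have "\<dots> = (x - y) * (u N * v N) + b N * (u N * v (N - 1) - u (N - 1) * v N)"
    unfolding assms(1,2) by (simp add: algebra_simps)
  also have "\<dots> = (x - y) * (\<Sum>n<Suc N. u n * v n)"
    using Suc by (simp add: algebra_simps)
  finally show ?case by simp
qed (simp add: assms)

text \<open>The case y = x, where the previous identity is empty. u' only has to satisfy the
  differentiated recurrence, so no limit is taken.\<close>

lemma christoffel_darboux_confluent:
  fixes u u' :: "nat \<Rightarrow> 'a :: comm_ring_1"
  assumes "\<And>n. b (Suc n) * u (Suc n) = (x - a n) * u n - b n * u (n - 1)"
    and "\<And>n. b (Suc n) * u' (Suc n) = u n + (x - a n) * u' n - b n * u' (n - 1)"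
    and "b 0 = 0"
  shows "(\<Sum>n<N. u n ^ 2) = b N * (u' N * u (N - 1) - u' (N - 1) * u N)"
proof (induction N)
  case (Suc N)
  have "b (Suc N) * (u' (Suc N) * u N - u' N * u (Suc N)) =
      (b (Suc N) * u' (Suc N)) * u N - u' N * (b (Suc N) * u (Suc N))"
    by (simp add: algebra_simps)
  also have "\<dots> = u N ^ 2 + b N * (u' N * u (N - 1) - u' (N - 1) * u N)"
    unfolding assms(1,2) by (simp add: algebra_simps power2_eq_square)
  also have "\<dots> = (\<Sum>n<Suc N. u n ^ 2)"
    using Suc by (simp add: algebra_simps)
  finally show ?case by simp
qed (simp add: assms)

lemma onl_has_deriv:
  "(onl \<alpha> n has_real_derivative (-1) ^ n * lag_weight \<alpha> n * poly (pderiv (laguerre \<alpha> n)) x) (at x)"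
  unfolding onl_real by (auto intro!: derivative_eq_intros)

text \<open>At a zero of L_N one boundary term of the confluent formula vanishes; this is the second
  identity. Replacing L_N' by L_(N-1) through \<open>laguerre_pderiv\<close> gives the first, which
  is the normalisation of the dual polynomials.\<close>

lemma onl_sum_squares:
  assumes "\<alpha> > -1" "poly (laguerre \<alpha> N) x = 0"
  shows "x * (\<Sum>n<N. onl \<alpha> n x ^ 2) = real N * (real N + \<alpha>) * onl \<alpha> (N - 1) x ^ 2"
    and "(\<Sum>n<N. onl \<alpha> n x ^ 2) =
      jac_b \<alpha> N * ((-1) ^ N * lag_weight \<alpha> N * poly (pderiv (laguerre \<alpha> N)) x * onl \<alpha> (N - 1) x)"
proof -
  define u' where "u' = (\<lambda>n. (-1) ^ n * lag_weight \<alpha> n * poly (pderiv (laguerre \<alpha> n)) x)"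
  \<comment> \<open>Obtained by differentiating \<open>onl_rec\<close> in x and comparing the two
    derivatives.\<close>
  have rec: "jac_b \<alpha> (Suc n) * u' (Suc n) =
      onl \<alpha> n x + (x - (2 * real n + 1 + \<alpha>)) * u' n - jac_b \<alpha> n * u' (n - 1)" for n
  proof -
    have "((\<lambda>x. jac_b \<alpha> (Suc n) * onl \<alpha> (Suc n) x) has_real_derivative jac_b \<alpha> (Suc n) * u' (Suc n)) (at x)"
      unfolding u'_def by (rule DERIV_cmult[OF onl_has_deriv])
    moreover have "((\<lambda>x. jac_b \<alpha> (Suc n) * onl \<alpha> (Suc n) x) has_real_derivative
        onl \<alpha> n x + (x - (2 * real n + 1 + \<alpha>)) * u' n - jac_b \<alpha> n * u' (n - 1)) (at x)"
      using onl_rec[OF assms(1), of n, where ?'a = real] unfolding u'_def of_real_eq_id id_def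
      by (auto intro!: derivative_eq_intros onl_has_deriv)
    ultimately show ?thesis by (rule DERIV_unique)
  qed
  have 0: "onl \<alpha> N x = 0" using assms(2) by (simp add: onl_real)
  have "(\<Sum>n<N. onl \<alpha> n x ^ 2) = jac_b \<alpha> N * (u' N * onl \<alpha> (N - 1) x - u' (N - 1) * onl \<alpha> N x)"
    by (rule christoffel_darboux_confluent[where x = x and a = "\<lambda>n. 2 * real n + 1 + \<alpha>"])
      (use onl_rec[OF assms(1), where x = x] rec in auto)
  then have *: "(\<Sum>n<N. onl \<alpha> n x ^ 2) = jac_b \<alpha> N * (u' N * onl \<alpha> (N - 1) x)"
    using 0 by simp
  then show "(\<Sum>n<N. onl \<alpha> n x ^ 2) =
      jac_b \<alpha> N * ((-1) ^ N * lag_weight \<alpha> N * poly (pderiv (laguerre \<alpha> N)) x * onl \<alpha> (N - 1) x)"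
    by (simp add: u'_def)
  show "x * (\<Sum>n<N. onl \<alpha> n x ^ 2) = real N * (real N + \<alpha>) * onl \<alpha> (N - 1) x ^ 2"
  proof (cases N)
    case (Suc n)
    have "x * poly (pderiv (laguerre \<alpha> N)) x = - (real N + \<alpha>) * poly (laguerre \<alpha> n) x"
      using arg_cong[OF laguerre_pderiv[of \<alpha> n], of "\<lambda>p. poly p x"] assms(2) Suc
      by (simp add: algebra_simps)
    then have "x * u' N = (-1) ^ N * lag_weight \<alpha> N * (- (real N + \<alpha>) * poly (laguerre \<alpha> n) x)"
      unfolding u'_def by (simp add: mult_ac)
    also have "\<dots> = (-1) ^ n * ((real (Suc n) + \<alpha>) * lag_weight \<alpha> (Suc n)) * poly (laguerre \<alpha> n) x"
      by (simp add: Suc algebra_simps)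
    also have "\<dots> = jac_b \<alpha> N * onl \<alpha> n x"
      unfolding lag_weight_Suc2[OF assms(1), symmetric] by (simp add: onl_real Suc)
    finally have "x * u' N = jac_b \<alpha> N * onl \<alpha> n x" .
    then have "x * (jac_b \<alpha> N * (u' N * onl \<alpha> (N - 1) x)) = jac_b \<alpha> N ^ 2 * onl \<alpha> (N - 1) x ^ 2"
      by (simp add: Suc power2_eq_square)
    then show ?thesis unfolding * jac_b_square[OF assms(1)] by simp
  qed simp
qed

section \<open>The zeros are real, positive and simple\<close>

lemma laguerre_nonzero: "laguerre \<alpha> N \<noteq> 0"
proof
  assume "laguerre \<alpha> N = 0"
  then have "coeff (laguerre \<alpha> N) N = 0" by simp
  then show False by (simp add: coeff_laguerre)
qed

lemma onl_sum_squares_pos: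
  assumes "N > 0"
  shows "(\<Sum>n<N. (onl \<alpha> n x :: real) ^ 2) > 0"
  by (rule sum_pos2[of _ 0]) (use assms in auto)

text \<open>The sum of squares contains \<open>onl \<alpha> 0 x = 1\<close>, so it is positive. By
  \<open>onl_sum_squares\<close> every factor of the other expressions is then nonzero, and
  comparing signs gives x > 0.\<close>

lemma laguerre_zero_simple:
  assumes "\<alpha> > -1" "N > 0" "poly (laguerre \<alpha> N) x = 0"
  shows "x > 0" "onl \<alpha> (N - 1) x \<noteq> 0" "poly (pderiv (laguerre \<alpha> N)) x \<noteq> 0"
proof -
  note S = onl_sum_squares_pos[OF assms(2), of \<alpha> x]
  have N: "real N * (real N + \<alpha>) > 0" using assms by auto
  show "onl \<alpha> (N - 1) x \<noteq> 0" "poly (pderiv (laguerre \<alpha> N)) x \<noteq> 0"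
    using S onl_sum_squares(2)[OF assms(1,3)] by auto
  then have "real N * (real N + \<alpha>) * onl \<alpha> (N - 1) x ^ 2 > 0"
    using N by simp
  then show "x > 0" unfolding onl_sum_squares(1)[OF assms(1,3), symmetric]
    using S by (simp add: zero_less_mult_iff)
qed

lemma onl_cnj: "onl \<alpha> n (cnj w) = cnj (onl \<alpha> n w)"
  by (simp add: onl_def poly_altdef coeff_map_poly degree_map_poly)

lemma poly_map_poly_of_real:
  "poly (map_poly of_real p) (of_real x) = (of_real (poly p x) :: 'a :: real_field)"
  by (induction p) (auto simp: map_poly_pCons)

text \<open>With w and its conjugate both zeros, Christoffel-Darboux gives (w - cnj w) times a
  positive sum of squared moduli equal to 0.\<close>

lemma laguerre_complex_zero_real:
  fixes w :: complex
  assumes "\<alpha> > -1" "N > 0" "poly (laguerre_map \<alpha> N) w = 0"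
  shows "w = of_real (Re w)" "poly (laguerre \<alpha> N) (Re w) = 0"
proof -
  have "onl \<alpha> N w = 0" using assms by (simp add: onl_def)
  then have "(w - cnj w) * (\<Sum>n<N. onl \<alpha> n w * onl \<alpha> n (cnj w)) = 0"
    by (subst christoffel_darboux[where a = "\<lambda>n. of_real (2 * real n + 1 + \<alpha>)" and b = "\<lambda>n. of_real (jac_b \<alpha> n)"])
      (use onl_rec[OF assms(1)] onl_cnj[of \<alpha> N w] in auto)
  moreover have "(\<Sum>n<N. onl \<alpha> n w * onl \<alpha> n (cnj w)) = of_real (\<Sum>n<N. norm (onl \<alpha> n w) ^ 2)"
    unfolding onl_cnj complex_norm_square[symmetric] by simp
  moreover have "(\<Sum>n<N. norm (onl \<alpha> n w) ^ 2) > 0"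
    by (rule sum_pos2[of _ 0]) (use assms in auto)
  ultimately have "w = cnj w"
    by (metis eq_iff_diff_eq_0 less_irrefl mult_eq_0_iff of_real_eq_0_iff)
  then show *: "w = of_real (Re w)" by (simp add: complex_eq_iff)
  then have "of_real (poly (laguerre \<alpha> N) (Re w)) = poly (laguerre_map \<alpha> N) w"
    by (metis poly_map_poly_of_real)
  with assms(3) show "poly (laguerre \<alpha> N) (Re w) = 0" by simp
qed

text \<open>Over the complex numbers there are N zeros with multiplicity; they are simple and all
  lie on the real line.\<close>

lemma card_laguerre_zeros:
  assumes "\<alpha> > -1" "N > 0"
  shows "card (laguerre_zeros \<alpha> N) = N"
proof -
  define p :: "complex poly" where "p = laguerre_map \<alpha> N"
  have deg: "degree p = N" by (simp add: p_def degree_map_poly degree_laguerre)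
  have "p \<noteq> 0" using deg assms(2) by auto
  have zeros: "{w. poly p w = 0} = of_real ` laguerre_zeros \<alpha> N"
    using laguerre_complex_zero_real[OF assms]
    by (force simp: poly_map_poly_of_real p_def laguerre_zeros_def)
  have pd: "pderiv p = map_poly of_real (pderiv (laguerre \<alpha> N))"
    by (rule poly_eqI) (simp add: p_def coeff_pderiv coeff_map_poly)
  have "poly (pderiv p) w \<noteq> 0" if "poly p w = 0" for w
  proof -
    from that zeros obtain x where x: "w = of_real x" "poly (laguerre \<alpha> N) x = 0"
      by (auto simp: laguerre_zeros_def)
    then show ?thesis using laguerre_zero_simple(3)[OF assms x(2)] by (simp add: pd poly_map_poly_of_real)
  qed
  then have "rsquarefree p" unfolding rsquarefree_roots by blast
  then have "order w p = 1" if "poly p w = 0" for w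
    using that by (simp add: rsquarefree_root_order \<open>p \<noteq> 0\<close>)
  then have "size (proots p) = card {w. poly p w = 0}"
    using \<open>p \<noteq> 0\<close> by (simp add: size_multiset_overloaded_eq)
  then have "card {w. poly p w = 0} = N" by (simp add: size_proots_complex deg)
  then show ?thesis unfolding zeros by (simp add: card_image inj_on_def)
qed

section \<open>The dual polynomials\<close>

definition zero_form :: "real \<Rightarrow> nat \<Rightarrow> real poly \<Rightarrow> real poly \<Rightarrow> real" where
  "zero_form \<alpha> N p q = (\<Sum>z\<in>laguerre_zeros \<alpha> N. z * poly p z * poly q z)"

lemma zero_form_simps:
  "zero_form \<alpha> N p (q + r) = zero_form \<alpha> N p q + zero_form \<alpha> N p r"
  "zero_form \<alpha> N p (q - r) = zero_form \<alpha> N p q - zero_form \<alpha> N p r"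
  "zero_form \<alpha> N p (smult c q) = c * zero_form \<alpha> N p q"
  by (simp_all add: zero_form_def algebra_simps sum.distrib sum_subtractf sum_distrib_left)

lemma zero_form_commute: "zero_form \<alpha> N p q = zero_form \<alpha> N q p"
  by (simp add: zero_form_def mult_ac)

lemma is_dual_laguerre_alt:
  "is_dual_laguerre \<alpha> N Q \<longleftrightarrow>
     (\<forall>k<N. degree (Q k) = k \<and> lead_coeff (Q k) > 0) \<and>
     (\<forall>k<N. \<forall>l<N. zero_form \<alpha> N (Q k) (Q l) = (if k = l then 1 else 0))"
  by (simp add: is_dual_laguerre_def zero_form_def)

text \<open>The zero polynomial has degree 0, so the degree of a constant cannot drop; constants are
  treated separately wherever this is applied.\<close>

lemma degree_less_cancel_lead:
  fixes p q :: "real poly"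
  assumes "degree q = degree p" "degree p > 0"
  shows "degree (p - smult (lead_coeff p / lead_coeff q) q) < degree p"
proof -
  have "q \<noteq> 0" using assms by auto
  have "degree (p - smult (lead_coeff p / lead_coeff q) q) \<le> degree p"
    using assms by (intro degree_diff_le) (auto intro: order_trans[OF degree_smult_le])
  moreover have "coeff (p - smult (lead_coeff p / lead_coeff q) q) (degree p) = 0"
  proof -
    have "coeff q (degree p) \<noteq> 0" using assms(1) \<open>q \<noteq> 0\<close> by (metis leading_coeff_0_iff)
    then show ?thesis by (simp add: assms(1))
  qed
  ultimately show ?thesis
    using assms(2) by (metis eq_zero_or_degree_less degree_0)
qed

text \<open>Induction on the degree: subtracting a multiple of Q of the same degree cancels the
  leading term of p, and Q_k is orthogonal to what is subtracted.\<close>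

lemma zero_form_lower_degree:
  assumes "is_dual_laguerre \<alpha> N Q" "k < N" "degree p < k"
  shows "zero_form \<alpha> N (Q k) p = 0"
  using assms(3)
proof (induction "degree p" arbitrary: p rule: less_induct)
  case less
  let ?c = "lead_coeff p / lead_coeff (Q (degree p))"
  define r where "r = p - smult ?c (Q (degree p))"
  have d: "degree (Q (degree p)) = degree p" and nz: "lead_coeff (Q (degree p)) > 0"
    using assms(1) less_trans[OF less.prems assms(2)] unfolding is_dual_laguerre_def by blast+
  have "zero_form \<alpha> N (Q k) (Q (degree p)) = 0"
    using assms less.prems unfolding is_dual_laguerre_alt by auto
  moreover have "zero_form \<alpha> N (Q k) r = 0"
  proof (cases "degree p = 0")
    case True
    then obtain a b where "p = [:a:]" "Q (degree p) = [:b:]"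
      using d by (metis degree_eq_zeroE)
    then have "r = 0" using nz by (auto simp: r_def)
    then show ?thesis by (simp add: zero_form_def)
  next
    case False
    then have "degree r < degree p"
      unfolding r_def using degree_less_cancel_lead[OF d] by simp
    then show ?thesis using less.hyps less.prems by simp
  qed
  moreover have "p = r + smult ?c (Q (degree p))" by (simp add: r_def)
  ultimately show ?case
    using zero_form_simps(1,3) by (metis add_0 mult_zero_right)
qed

lemma finite_laguerre_zeros: "finite (laguerre_zeros \<alpha> N)"
  unfolding laguerre_zeros_def by (rule poly_roots_finite[OF laguerre_nonzero])

lemma poly_eq_0_on_laguerre_zeros:
  assumes "\<alpha> > -1" "degree p < N" "\<And>z. z \<in> laguerre_zeros \<alpha> N \<Longrightarrow> poly p z = 0"
  shows "p = 0"
proof (rule ccontr)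
  assume "p \<noteq> 0"
  have "N = card (laguerre_zeros \<alpha> N)" using card_laguerre_zeros assms by simp
  also have "\<dots> \<le> card {z. poly p z = 0}"
    using assms(3) poly_roots_finite[OF \<open>p \<noteq> 0\<close>] by (intro card_mono) auto
  also have "\<dots> \<le> degree p" by (rule card_poly_roots_bound[OF \<open>p \<noteq> 0\<close>])
  finally show False using assms(2) by simp
qed

text \<open>The weights z are positive, so p vanishes at all N zeros, too many for its
  degree.\<close>

lemma zero_form_definite:
  assumes "\<alpha> > -1" "degree p < N" "zero_form \<alpha> N p p = 0"
  shows "p = 0"
proof (rule poly_eq_0_on_laguerre_zeros[OF assms(1,2)])
  have N: "N > 0" using assms(2) by simp
  fix z assume z: "z \<in> laguerre_zeros \<alpha> N"
  have pos: "z > 0" if "z \<in> laguerre_zeros \<alpha> N" for z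
    using that laguerre_zero_simple(1)[OF assms(1) N] by (simp add: laguerre_zeros_def)
  then have "\<forall>z\<in>laguerre_zeros \<alpha> N. z * poly p z * poly p z = 0"
    using assms(3) unfolding zero_form_def
    by (subst (asm) sum_nonneg_eq_0_iff) (auto simp: finite_laguerre_zeros mult.assoc less_imp_le)
  then show "poly p z = 0" using pos[OF z] z by force
qed

text \<open>After cancelling leading terms the remainder has degree below k, hence is orthogonal to
  Q_k and R_k and so to itself. Definiteness makes Q_k proportional to R_k; unit norm and positive
  leading coefficients make the factor 1.\<close>

lemma dual_laguerre_unique:
  assumes "\<alpha> > -1" "is_dual_laguerre \<alpha> N Q" "is_dual_laguerre \<alpha> N R" "k < N"
  shows "Q k = R k"
proof -
  define c where "c = lead_coeff (Q k) / lead_coeff (R k)"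
  have d: "degree (Q k) = k" "degree (R k) = k" "lead_coeff (Q k) > 0" "lead_coeff (R k) > 0"
    and n: "zero_form \<alpha> N (Q k) (Q k) = 1" "zero_form \<alpha> N (R k) (R k) = 1"
    using assms unfolding is_dual_laguerre_alt by auto
  define r where "r = Q k - smult c (R k)"
  have "r = 0"
  proof (cases "k = 0")
    case True
    then obtain a b where "Q k = [:a:]" "R k = [:b:]"
      using d by (metis degree_eq_zeroE)
    then show ?thesis using d by (auto simp: r_def c_def)
  next
    case False
    then have r: "degree r < k"
      unfolding r_def c_def using degree_less_cancel_lead[of "R k" "Q k"] d by simp
    have "zero_form \<alpha> N r r = zero_form \<alpha> N r (Q k) - c * zero_form \<alpha> N r (R k)"
      by (simp add: r_def zero_form_simps)
    also have "\<dots> = 0"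
      using zero_form_lower_degree[OF _ assms(4) r] assms(2,3) by (simp add: zero_form_commute[of _ _ r])
    finally show ?thesis using r assms(4) by (intro zero_form_definite[OF assms(1)]) auto
  qed
  then have Q: "Q k = smult c (R k)" by (simp add: r_def)
  have "c > 0" using d by (simp add: c_def)
  have "zero_form \<alpha> N (Q k) (Q k) = c * (c * zero_form \<alpha> N (R k) (R k))"
    unfolding Q zero_form_simps(3) zero_form_commute[of _ _ "smult c (R k)"] by simp
  then have "c ^ 2 = 1" using n by (simp add: power2_eq_square)
  with \<open>c > 0\<close> have "c = 1" by (simp add: power2_eq_1_iff)
  with Q show ?thesis by simp
qed

text \<open>The dual family has the Jacobi matrix of the Laguerre polynomials with rows and columns
  in reverse order. Only the indices \<open>k < N\<close> are meaningful (\<open>jac_b \<alpha> 0 = 0\<close> appears as a divisor at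
  \<open>k = N\<close>).\<close>

fun dual_rec :: "real \<Rightarrow> nat \<Rightarrow> nat \<Rightarrow> real poly" where
  "dual_rec \<alpha> N 0 = [:1 / jac_b \<alpha> N:]"
| "dual_rec \<alpha> N (Suc 0) = smult (1 / jac_b \<alpha> (N - 1))
     ([:- (2 * real N + \<alpha> - 1), 1:] * dual_rec \<alpha> N 0)"
| "dual_rec \<alpha> N (Suc (Suc k)) = smult (1 / jac_b \<alpha> (N - Suc (Suc k)))
     ([:- (2 * real (N - Suc k) + \<alpha> - 1), 1:] * dual_rec \<alpha> N (Suc k)
       - smult (jac_b \<alpha> (N - Suc k)) (dual_rec \<alpha> N k))"

lemma dual_rec_lead:
  assumes "\<alpha> > -1" "k < N"
  shows "degree (dual_rec \<alpha> N k) = k \<and> lead_coeff (dual_rec \<alpha> N k) > 0"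
  using assms
proof (induction \<alpha> N k rule: dual_rec.induct)
  case (1 \<alpha> N)
  then show ?case using jac_b_pos[of \<alpha> N] by simp
next
  case (2 \<alpha> N)
  then show ?case using jac_b_pos[of \<alpha> N] jac_b_pos[of \<alpha> "N - 1"] by simp
next
  case (3 \<alpha> N k)
  define A where "A = [:- (2 * real (N - Suc k) + \<alpha> - 1), 1:] * dual_rec \<alpha> N (Suc k)"
  define B where "B = smult (jac_b \<alpha> (N - Suc k)) (dual_rec \<alpha> N k)"
  have b: "jac_b \<alpha> (N - Suc (Suc k)) > 0" using 3 by (intro jac_b_pos) auto
  have IH: "degree (dual_rec \<alpha> N (Suc k)) = Suc k" "lead_coeff (dual_rec \<alpha> N (Suc k)) > 0"
    "degree (dual_rec \<alpha> N k) = k"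
    using 3 by auto
  then have "dual_rec \<alpha> N (Suc k) \<noteq> 0" by auto
  then have "degree A = Suc (Suc k)"
    unfolding A_def by (subst degree_mult_eq) (use IH in auto)
  moreover have "lead_coeff A > 0"
    unfolding A_def lead_coeff_mult using IH by simp
  ultimately have A: "degree A = Suc (Suc k)" "lead_coeff A > 0" by auto
  have "degree B < degree A" using A IH degree_smult_le[of "jac_b \<alpha> (N - Suc k)" "dual_rec \<alpha> N k"]
    by (simp add: B_def)
  then have "degree (A - B) = Suc (Suc k)" "lead_coeff (A - B) = lead_coeff A"
    using A degree_add_eq_left[of "-B" A] lead_coeff_add_le[of "-B" A]
    by (auto simp: coeff_eq_0)
  moreover have "dual_rec \<alpha> N (Suc (Suc k)) = smult (1 / jac_b \<alpha> (N - Suc (Suc k))) (A - B)"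
    by (simp add: A_def B_def)
  ultimately show ?case using b A by (auto simp: zero_less_divide_iff)
qed

text \<open>Only at a zero x of L_N does the Laguerre recurrence, read downwards from N - 1, begin
  as \<open>dual_rec\<close> does; the two then agree up to a constant factor.\<close>

lemma dual_rec_at_zero:
  assumes "\<alpha> > -1" "poly (laguerre \<alpha> N) x = 0" "k < N"
  shows "poly (dual_rec \<alpha> N k) x = onl \<alpha> (N - 1 - k) x / (jac_b \<alpha> N * onl \<alpha> (N - 1) x)"
  using assms
proof (induction \<alpha> N k rule: dual_rec.induct)
  case (1 \<alpha> N)
  then show ?case using laguerre_zero_simple(2)[of \<alpha> N x] by simp
next
  case (2 \<alpha> N)
  then obtain n where N: "N = Suc (Suc n)" by (metis Suc_diff_Suc Suc_lessD diff_zero)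
  have nz: "onl \<alpha> (Suc n) x \<noteq> 0" "jac_b \<alpha> N > 0" "jac_b \<alpha> (Suc n) > 0"
    using laguerre_zero_simple(2)[of \<alpha> N x] 2 by (auto simp: N intro: jac_b_pos)
  \<comment> \<open>The vanishing of \<open>onl \<alpha> N x\<close> removes the neighbour above
    index N - 1 and gives the two-term start of \<open>dual_rec\<close>.\<close>
  have "onl \<alpha> (Suc (Suc n)) x = 0" using 2 by (simp add: onl_real N)
  then have "(x - (2 * real (Suc n) + 1 + \<alpha>)) * onl \<alpha> (Suc n) x = jac_b \<alpha> (Suc n) * onl \<alpha> n x"
    using onl_rec[of \<alpha> "Suc n" x] 2 by simp
  then have "onl \<alpha> n x = (x - (2 * real N + \<alpha> - 1)) * onl \<alpha> (Suc n) x / jac_b \<alpha> (Suc n)"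
    using nz by (simp add: N field_simps)
  moreover have "poly (dual_rec \<alpha> N (Suc 0)) x =
      (x - (2 * real N + \<alpha> - 1)) / (jac_b \<alpha> (N - 1) * jac_b \<alpha> N)"
    using nz by (simp add: N divide_simps)
  ultimately show ?case using nz by (simp add: N)
next
  case (3 \<alpha> N k)
  obtain n where N: "N = Suc (Suc k) + Suc n" using 3(5)
    by (metis less_natE add_Suc_right add_Suc)
  have nz: "onl \<alpha> (N - 1) x \<noteq> 0" "jac_b \<alpha> N > 0" "jac_b \<alpha> (Suc n) > 0"
    using laguerre_zero_simple(2)[of \<alpha> N x] 3 by (auto simp: N intro: jac_b_pos)
  have ix: "N - 1 - k = Suc (Suc n)" "N - 1 - Suc k = Suc n" "N - 1 - Suc (Suc k) = n" "N - Suc k = Suc (Suc n)"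
    "N - Suc (Suc k) = Suc n"
    by (auto simp: N)
  have rec: "onl \<alpha> n x = 1 / jac_b \<alpha> (Suc n) *
     ((x - (2 * real (Suc (Suc n)) + \<alpha> - 1)) * onl \<alpha> (Suc n) x - jac_b \<alpha> (Suc (Suc n)) * onl \<alpha> (Suc (Suc n)) x)"
    using onl_rec[of \<alpha> "Suc n" x] 3(3) nz by (simp add: field_simps)
  have IH: "poly (dual_rec \<alpha> N (Suc k)) x = onl \<alpha> (Suc n) x / (jac_b \<alpha> N * onl \<alpha> (N - 1) x)"
    "poly (dual_rec \<alpha> N k) x = onl \<alpha> (Suc (Suc n)) x / (jac_b \<alpha> N * onl \<alpha> (N - 1) x)"
    using 3 ix by auto
  have "poly (dual_rec \<alpha> N (Suc (Suc k))) x = 1 / jac_b \<alpha> (Suc n) *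
     ((x - (2 * real (Suc (Suc n)) + \<alpha> - 1)) * poly (dual_rec \<alpha> N (Suc k)) x
       - jac_b \<alpha> (Suc (Suc n)) * poly (dual_rec \<alpha> N k) x)"
    by (simp add: ix algebra_simps)
  also have "\<dots> = onl \<alpha> n x / (jac_b \<alpha> N * onl \<alpha> (N - 1) x)"
    unfolding IH rec by (simp add: diff_divide_distrib mult_ac)
  finally show ?case unfolding ix(3) .
qed

text \<open>Orthogonality over the index k at pairs of zeros. Off the diagonal both
  Christoffel-Darboux boundary terms vanish; on it the value is \<open>onl_sum_squares(1)\<close>.
  Reversing the index leaves the sum unchanged.\<close>

lemma dual_rec_kernel:
  assumes "\<alpha> > -1" "N > 0" "x \<in> laguerre_zeros \<alpha> N" "y \<in> laguerre_zeros \<alpha> N"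
  shows "y * (\<Sum>k<N. poly (dual_rec \<alpha> N k) x * poly (dual_rec \<alpha> N k) y) = (if x = y then 1 else 0)"
proof -
  have z: "poly (laguerre \<alpha> N) x = 0" "poly (laguerre \<alpha> N) y = 0"
    using assms by (auto simp: laguerre_zeros_def)
  have o: "onl \<alpha> N x = 0" "onl \<alpha> N y = 0" using z by (auto simp: onl_real)
  define c where "c = (\<lambda>x. 1 / (jac_b \<alpha> N * onl \<alpha> (N - 1) x))"
  have "(\<Sum>k<N. poly (dual_rec \<alpha> N k) x * poly (dual_rec \<alpha> N k) y) =
      (\<Sum>k<N. c x * c y * (onl \<alpha> (N - 1 - k) x * onl \<alpha> (N - 1 - k) y))"
    by (intro sum.cong) (auto simp: dual_rec_at_zero[OF assms(1) z(1)] dual_rec_at_zero[OF assms(1) z(2)] c_def)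
  also have "\<dots> = c x * c y * (\<Sum>k<N. onl \<alpha> (N - 1 - k) x * onl \<alpha> (N - 1 - k) y)"
    by (simp add: sum_distrib_left)
  also have "(\<Sum>k<N. onl \<alpha> (N - 1 - k) x * onl \<alpha> (N - 1 - k) y) = (\<Sum>n<N. onl \<alpha> n x * onl \<alpha> n y)"
    by (rule sum.reindex_bij_witness[of _ "\<lambda>n. N - 1 - n" "\<lambda>n. N - 1 - n"]) auto
  finally have *: "(\<Sum>k<N. poly (dual_rec \<alpha> N k) x * poly (dual_rec \<alpha> N k) y) =
      c x * c y * (\<Sum>n<N. onl \<alpha> n x * onl \<alpha> n y)" .
  show ?thesis
  proof (cases "x = y")
    case True
    have "onl \<alpha> (N - 1) x \<noteq> 0" by (rule laguerre_zero_simple(2)[OF assms(1,2) z(1)])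
    moreover have "jac_b \<alpha> N > 0" by (rule jac_b_pos[OF assms(1,2)])
    moreover have "x * (\<Sum>n<N. onl \<alpha> n x * onl \<alpha> n x) = jac_b \<alpha> N ^ 2 * onl \<alpha> (N - 1) x ^ 2"
      using onl_sum_squares(1)[OF assms(1) z(1)] jac_b_square[OF assms(1), of N]
      by (simp add: power2_eq_square)
    ultimately show ?thesis unfolding * using True
      by (simp add: c_def field_simps power2_eq_square)
  next
    case False
    have "(x - y) * (\<Sum>n<N. onl \<alpha> n x * onl \<alpha> n y) =
        jac_b \<alpha> N * (onl \<alpha> N x * onl \<alpha> (N - 1) y - onl \<alpha> (N - 1) x * onl \<alpha> N y)"
      by (rule christoffel_darboux[where a = "\<lambda>n. 2 * real n + 1 + \<alpha>"])
        (use onl_rec[OF assms(1), where ?'a = real] in auto)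
    then have "(\<Sum>n<N. onl \<alpha> n x * onl \<alpha> n y) = 0" using False o by simp
    then show ?thesis unfolding * using False by simp
  qed
qed

text \<open>The highest coefficient meets only the last summand, so the scalars vanish one by one
  from the top.\<close>

lemma triangular_family_independent:
  fixes P :: "nat \<Rightarrow> real poly"
  assumes "\<And>k. k < N \<Longrightarrow> degree (P k) = k \<and> P k \<noteq> 0" "(\<Sum>k<N. smult (c k) (P k)) = 0" "k < N"
  shows "c k = 0"
  using assms
proof (induction N)
  case (Suc N)
  have "coeff (\<Sum>k<Suc N. smult (c k) (P k)) N = c N * coeff (P N) N"
  proof -
    have "coeff (P k) N = 0" if "k < N" for k
      using Suc.prems(1)[of k] that by (intro coeff_eq_0) auto
    then show ?thesis by (simp add: coeff_sum)
  qed
  moreover have "coeff (P N) N \<noteq> 0"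
    using Suc.prems(1)[of N] by (metis leading_coeff_0_iff lessI)
  ultimately have "c N = 0" using Suc.prems(2) by (metis coeff_0 mult_eq_0_iff)
  then show ?case
    using Suc.IH Suc.prems by (cases "k = N") auto
qed simp

text \<open>The sums over the zeros reproduce each \<open>R\<^sub>l = dual_rec \<alpha> N l\<close> from the kernel
  \<open>\<Sum>k<N. R\<^sub>k(x) R\<^sub>k(z)\<close>, and comparing coefficients in the basis \<open>R\<^sub>k\<close> gives orthonormality.\<close>

lemma is_dual_laguerre_dual_rec:
  assumes "\<alpha> > -1"
  shows "is_dual_laguerre \<alpha> N (dual_rec \<alpha> N)"
  unfolding is_dual_laguerre_alt
proof (intro conjI allI impI)
  fix k l assume kl: "k < N" "l < N"
  let ?R = "dual_rec \<alpha> N"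
  let ?Z = "laguerre_zeros \<alpha> N"
  define d where "d = (\<lambda>k. zero_form \<alpha> N (?R k) (?R l) - (if k = l then 1 else 0))"
  have N: "N > 0" using kl by simp
  have "(\<Sum>k<N. smult (d k) (?R k)) = 0"
  proof (rule poly_eq_0_on_laguerre_zeros[OF assms])
    show "degree (\<Sum>k<N. smult (d k) (?R k)) < N"
      using dual_rec_lead[OF assms, of _ N] N degree_smult_le
      by (intro degree_sum_less) (auto intro: le_less_trans[OF degree_smult_le])
    fix x assume x: "x \<in> ?Z"
    have "(\<Sum>k<N. zero_form \<alpha> N (?R k) (?R l) * poly (?R k) x) =
        (\<Sum>k<N. \<Sum>z\<in>?Z. poly (?R l) z * (z * (poly (?R k) x * poly (?R k) z)))"
      by (simp add: zero_form_def sum_distrib_left sum_distrib_right mult_ac)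
    also have "\<dots> = (\<Sum>z\<in>?Z. poly (?R l) z * (z * (\<Sum>k<N. poly (?R k) x * poly (?R k) z)))"
      by (subst sum.swap) (simp add: sum_distrib_left)
    also have "\<dots> = (\<Sum>z\<in>?Z. if x = z then poly (?R l) z else 0)"
      by (intro sum.cong refl) (simp add: dual_rec_kernel[OF assms N x])
    also have "\<dots> = poly (?R l) x"
      using x by (simp add: finite_laguerre_zeros)
    finally show "poly (\<Sum>k<N. smult (d k) (?R k)) x = 0"
      using kl by (simp add: poly_sum d_def left_diff_distrib sum_subtractf if_distrib[of "\<lambda>t. t * _"] cong: if_cong)
  qed
  then have "d k = 0"
    using dual_rec_lead[OF assms, of _ N] kl by (intro triangular_family_independent[of N ?R d]) force+
  then show "zero_form \<alpha> N (?R k) (?R l) = (if k = l then 1 else 0)" by (simp add: d_def)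
qed (use dual_rec_lead[OF assms] in blast)+

lemma dual_laguerre_eq_dual_rec:
  assumes "\<alpha> > -1" "k < N"
  shows "dual_laguerre \<alpha> N k = dual_rec \<alpha> N k"
proof (rule dual_laguerre_unique[OF assms(1) _ is_dual_laguerre_dual_rec[OF assms(1)] assms(2)])
  show "is_dual_laguerre \<alpha> N (dual_laguerre \<alpha> N)"
    unfolding dual_laguerre_def
    by (rule someI[where P = "is_dual_laguerre \<alpha> N", OF is_dual_laguerre_dual_rec[OF assms(1)]])
qed

section \<open>The top eigenvector\<close>

lemma largest_laguerre_zero:
  assumes "\<alpha> > -1" "N > 0"
  shows "poly (laguerre \<alpha> N) (largest_laguerre_zero \<alpha> N) = 0"
    and "poly (laguerre \<alpha> N) x = 0 \<Longrightarrow> x \<le> largest_laguerre_zero \<alpha> N"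
    and "largest_laguerre_zero \<alpha> N > 0"
proof -
  have "laguerre_zeros \<alpha> N \<noteq> {}" using card_laguerre_zeros[OF assms] assms(2) by auto
  then have "largest_laguerre_zero \<alpha> N \<in> laguerre_zeros \<alpha> N"
    unfolding largest_laguerre_zero_def by (intro Max_in finite_laguerre_zeros)
  then show *: "poly (laguerre \<alpha> N) (largest_laguerre_zero \<alpha> N) = 0"
    by (simp add: laguerre_zeros_def)
  show "largest_laguerre_zero \<alpha> N > 0" by (rule laguerre_zero_simple(1)[OF assms *])
  show "x \<le> largest_laguerre_zero \<alpha> N" if "poly (laguerre \<alpha> N) x = 0"
    unfolding largest_laguerre_zero_def
    by (rule Max_ge[OF finite_laguerre_zeros]) (use that in \<open>simp add: laguerre_zeros_def\<close>)
qed

text \<open>The leading coefficient of (-1)^N L_N is positive, so a nonpositive value would produce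
  a zero further to the right.\<close>

lemma onl_pos_above_largest_zero:
  assumes "\<alpha> > -1" "N > 0" "x > largest_laguerre_zero \<alpha> N"
  shows "onl \<alpha> N x > 0"
proof (rule ccontr)
  define p where "p = smult ((-1) ^ N) (laguerre \<alpha> N)"
  have onl: "onl \<alpha> N y = lag_weight \<alpha> N * poly p y" for y
    by (simp add: onl_real p_def)
  assume "\<not> onl \<alpha> N x > 0"
  moreover have "poly p x \<noteq> 0"
    using largest_laguerre_zero(2)[OF assms(1,2), of x] assms(3) by (auto simp: p_def)
  ultimately have neg: "poly p x < 0"
    using lag_weight_pos[OF assms(1), of N] unfolding onl
    by (auto simp: zero_less_mult_iff)
  have "lead_coeff p = 1 / fact N"
    by (simp add: p_def degree_laguerre coeff_laguerre power_mult_distrib[symmetric])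
  then have lc: "lead_coeff p > 0" by simp
  then obtain n where n: "\<And>y. y \<ge> n \<Longrightarrow> poly p y \<ge> lead_coeff p"
    using poly_pinfty_gt_lc by blast
  define y where "y = max n (x + 1)"
  have "poly p y > 0" using n[of y] lc by (simp add: y_def)
  moreover have "x < y" by (simp add: y_def)
  ultimately obtain t where "t > x" "poly p t = 0"
    using poly_IVT_pos[of x y p] neg by auto
  then show False
    using largest_laguerre_zero(2)[OF assms(1,2), of t] assms(3) by (simp add: p_def)
qed

text \<open>The induction rests on the largest zeros increasing strictly with N, so a point at or
  beyond that of L_(N+1) lies strictly beyond that of L_N.\<close>

lemma onl_pos_at_largest_zero:
  assumes "\<alpha> > -1" "n < N" "x \<ge> largest_laguerre_zero \<alpha> N"
  shows "onl \<alpha> n x > 0"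
  using assms(2,3)
proof (induction N arbitrary: n x)
  case (Suc N)
  show ?case
  proof (cases "N = 0")
    case True
    then show ?thesis using Suc by simp
  next
    case False
    let ?z = "largest_laguerre_zero \<alpha> N" and ?z' = "largest_laguerre_zero \<alpha> (Suc N)"
    have "onl \<alpha> N ?z = 0" using largest_laguerre_zero(1)[OF assms(1), of N] False by (simp add: onl_real)
    \<comment> \<open>At the largest zero of L_N the recurrence gives \<open>onl\<close> of index N
      + 1 the sign opposite to index N - 1, so L_(N+1) has a larger zero.\<close>
    then have "jac_b \<alpha> (Suc N) * onl \<alpha> (Suc N) ?z = - (jac_b \<alpha> N * onl \<alpha> (N - 1) ?z)"
      using onl_rec[OF assms(1), of N ?z] by simp
    moreover have "jac_b \<alpha> N * onl \<alpha> (N - 1) ?z > 0"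
      using Suc.IH[of "N - 1" ?z] False jac_b_pos[OF assms(1), of N] by simp
    ultimately have "jac_b \<alpha> (Suc N) * onl \<alpha> (Suc N) ?z < 0" by linarith
    then have "onl \<alpha> (Suc N) ?z < 0"
      using jac_b_pos[OF assms(1), of "Suc N"] by (simp add: mult_less_0_iff)
    moreover have "onl \<alpha> (Suc N) y \<ge> 0" if "y \<ge> ?z'" for y
      using that onl_pos_above_largest_zero[OF assms(1), of "Suc N" y]
        largest_laguerre_zero(1)[OF assms(1), of "Suc N"]
      by (cases "y = ?z'") (auto simp: onl_real)
    ultimately have "?z < ?z'" by (meson not_le)
    then have "x > ?z" using Suc.prems by simp
    then show ?thesis
      using Suc.IH[of n x] Suc.prems(1) onl_pos_above_largest_zero[OF assms(1) _ \<open>x > ?z\<close>] False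
      by (cases "n = N") auto
  qed
qed simp

text \<open>The components \<open>sqrt z * Q\<^sub>k(z)\<close> of the normalised top eigenvector, with the index
  shifted by one so that the boundary value at index 0 is 0 (because \<open>onl \<alpha> N\<close> vanishes at \<open>z\<close>).\<close>

definition top_vec :: "real \<Rightarrow> nat \<Rightarrow> nat \<Rightarrow> real" where
  "top_vec \<alpha> N j = sqrt (largest_laguerre_zero \<alpha> N) * onl \<alpha> (N - j) (largest_laguerre_zero \<alpha> N)
     / (jac_b \<alpha> N * onl \<alpha> (N - 1) (largest_laguerre_zero \<alpha> N))"

context
  fixes \<alpha> :: real and N :: nat
  assumes \<alpha>: "\<alpha> > -1" and N: "N > 0"
begin

lemma top_vec_dual_laguerre:
  assumes "k < N"
  shows "sqrt (largest_laguerre_zero \<alpha> N) * poly (dual_laguerre \<alpha> N k) (largest_laguerre_zero \<alpha> N) =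
    top_vec \<alpha> N (Suc k)"
  using dual_rec_at_zero[OF \<alpha> largest_laguerre_zero(1)[OF \<alpha> N] assms]
  by (simp add: dual_laguerre_eq_dual_rec[OF \<alpha> assms] top_vec_def)

lemma top_vec_0: "top_vec \<alpha> N 0 = 0"
  using largest_laguerre_zero(1)[OF \<alpha> N] by (simp add: top_vec_def onl_real)

lemma top_vec_1: "top_vec \<alpha> N 1 = sqrt (largest_laguerre_zero \<alpha> N) / jac_b \<alpha> N"
  using laguerre_zero_simple(2)[OF \<alpha> N largest_laguerre_zero(1)[OF \<alpha> N]] by (simp add: top_vec_def)

lemma top_vec_pos:
  assumes "0 < j" "j \<le> N"
  shows "top_vec \<alpha> N j > 0"
  unfolding top_vec_def using assms largest_laguerre_zero(3)[OF \<alpha> N] jac_b_pos[OF \<alpha> N]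
  by (intro divide_pos_pos mult_pos_pos onl_pos_at_largest_zero[OF \<alpha>, where N = N]) auto

text \<open>A row of the Jacobi matrix in reversed order. For j = N - 1 the out-of-range component
  at N + 1 has coefficient \<open>jac_b \<alpha> 0 = 0\<close>.\<close>

lemma top_vec_rec:
  assumes "j < N"
  shows "largest_laguerre_zero \<alpha> N * top_vec \<alpha> N (Suc j) =
    jac_b \<alpha> (N - j) * top_vec \<alpha> N j + (2 * real (N - j) + \<alpha> - 1) * top_vec \<alpha> N (Suc j)
     + jac_b \<alpha> (N - Suc j) * top_vec \<alpha> N (Suc (Suc j))"
proof -
  obtain n where n: "N - j = Suc n" using assms by (metis Suc_diff_Suc)
  let ?z = "largest_laguerre_zero \<alpha> N"
  define S where "S = sqrt ?z / (jac_b \<alpha> N * onl \<alpha> (N - 1) ?z)"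
  have V: "top_vec \<alpha> N i = S * onl \<alpha> (N - i) ?z" for i
    by (simp add: top_vec_def S_def)
  have "N - Suc j = n" "N - Suc (Suc j) = n - 1" using n by auto
  moreover have "?z * onl \<alpha> n ?z = jac_b \<alpha> (Suc n) * onl \<alpha> (Suc n) ?z
      + (2 * real (Suc n) + \<alpha> - 1) * onl \<alpha> n ?z + jac_b \<alpha> n * onl \<alpha> (n - 1) ?z"
    using onl_rec[OF \<alpha>, of n ?z] by (simp add: algebra_simps)
  from arg_cong[OF this, of "\<lambda>t. S * t"]
  have "?z * (S * onl \<alpha> n ?z) = jac_b \<alpha> (Suc n) * (S * onl \<alpha> (Suc n) ?z)
      + (2 * real (Suc n) + \<alpha> - 1) * (S * onl \<alpha> n ?z) + jac_b \<alpha> n * (S * onl \<alpha> (n - 1) ?z)"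
    by (simp add: algebra_simps)
  ultimately show ?thesis by (simp add: V n)
qed

end

section \<open>Bounds for the largest zero\<close>

lemma jac_b_upper:
  assumes "\<alpha> > -1"
  shows "jac_b \<alpha> n \<le> real n + \<bar>\<alpha>\<bar> / 2"
proof (rule power2_le_imp_le)
  have "real n * \<alpha> \<le> real n * \<bar>\<alpha>\<bar>" by (intro mult_left_mono) auto
  then show "(jac_b \<alpha> n)\<^sup>2 \<le> (real n + \<bar>\<alpha>\<bar> / 2)\<^sup>2"
    unfolding jac_b_square[OF assms]
    by (auto simp: power2_eq_square algebra_simps intro: add_increasing2)
qed auto

lemma jac_b_lower:
  assumes "\<alpha> > -1"
  shows "real n - \<bar>\<alpha>\<bar> \<le> jac_b \<alpha> n"
proof (cases "real n \<le> \<bar>\<alpha>\<bar>")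
  case True
  then show ?thesis using jac_b_nonneg[OF assms, of n] by linarith
next
  case False
  have "(real n - \<bar>\<alpha>\<bar>) * (real n - \<bar>\<alpha>\<bar>) \<le> real n * (real n + \<alpha>)"
    using False by (intro mult_mono) auto
  then have "(real n - \<bar>\<alpha>\<bar>)\<^sup>2 \<le> (jac_b \<alpha> n)\<^sup>2"
    unfolding jac_b_square[OF assms] by (simp add: power2_eq_square)
  then show ?thesis
    by (rule power2_le_imp_le) (rule jac_b_nonneg[OF assms])
qed

text \<open>A discrete maximum principle, by induction from the end of the vector, where the
  outgoing entry is \<open>jac_b \<alpha> 0 = 0\<close>. The hypothesis places the eigenvalue above
  this row sum and all later ones, so a decrease in the next step forces one here.\<close>

lemma top_vec_decreasing:
  assumes "\<alpha> > -1" "j < N" "largest_laguerre_zero \<alpha> N > 4 * real (N - j) + 2 * \<bar>\<alpha>\<bar>"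
  shows "top_vec \<alpha> N (Suc j) < top_vec \<alpha> N j"
  using assms(2,3)
proof (induction "N - j" arbitrary: j)
  case (Suc n)
  let ?V = "top_vec \<alpha> N" and ?z = "largest_laguerre_zero \<alpha> N"
  have N: "N > 0" and n: "N - j = Suc n" "N - Suc j = n" using Suc by auto
  have pos: "?V (Suc j) > 0" using Suc by (intro top_vec_pos[OF assms(1) N]) auto
  have le: "jac_b \<alpha> n * ?V (Suc (Suc j)) \<le> jac_b \<alpha> n * ?V (Suc j)"
  proof (cases "n = 0")
    case False
    then have "?V (Suc (Suc j)) < ?V (Suc j)" using Suc n by (intro Suc.hyps(1)) auto
    then show ?thesis using jac_b_nonneg[OF assms(1), of n] by (intro mult_left_mono) auto
  qed simp
  have coef: "jac_b \<alpha> (Suc n) < ?z - (2 * real (Suc n) + \<alpha> - 1) - jac_b \<alpha> n"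
    using jac_b_upper[OF assms(1), of n] jac_b_upper[OF assms(1), of "Suc n"] Suc.prems(2) n by simp
  have "jac_b \<alpha> (Suc n) * ?V (Suc j) < (?z - (2 * real (Suc n) + \<alpha> - 1) - jac_b \<alpha> n) * ?V (Suc j)"
    using coef pos by (rule mult_strict_right_mono)
  also have "\<dots> \<le> jac_b \<alpha> (Suc n) * ?V j"
    using top_vec_rec[OF assms(1) N Suc.prems(1)] le n by (simp add: algebra_simps)
  finally show ?case using jac_b_pos[OF assms(1), of "Suc n"] by simp
qed simp

text \<open>A larger eigenvalue would make the vector decrease already from index 0, where it is 0,
  to index 1, where it is positive.\<close>

lemma largest_laguerre_zero_upper:
  assumes "\<alpha> > -1" "N > 0"
  shows "largest_laguerre_zero \<alpha> N \<le> 4 * real N + 2 * \<bar>\<alpha>\<bar>"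
proof (rule ccontr)
  assume "\<not> ?thesis"
  then have "top_vec \<alpha> N (Suc 0) < top_vec \<alpha> N 0"
    using assms by (intro top_vec_decreasing) auto
  then show False
    using top_vec_pos[OF assms, of "Suc 0"] top_vec_0[OF assms] assms by simp
qed

text \<open>Sturm comparison of the top eigenvector with the discrete sine \<open>sin (j \<pi> / M)\<close>: their
  weighted Wronskian would be strictly decreasing if the eigenvalue were too small.\<close>

lemma largest_laguerre_zero_lower_aux:
  assumes "\<alpha> > -1" "2 \<le> M" "M \<le> N" "real N - real M - \<bar>\<alpha>\<bar> \<ge> 0"
  shows "largest_laguerre_zero \<alpha> N \<ge>
    2 * (real N - real M) + \<alpha> + 1 + 2 * (real N - real M - \<bar>\<alpha>\<bar>) * cos (pi / M)"
proof (rule ccontr)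
  let ?V = "top_vec \<alpha> N" and ?z = "largest_laguerre_zero \<alpha> N"
  \<comment> \<open>A lower bound for every off-diagonal entry that occurs in the first M
    rows.\<close>
  define \<beta> where "\<beta> = real N - real M - \<bar>\<alpha>\<bar>"
  define \<theta> where "\<theta> = pi / real M"
  define \<phi> where "\<phi> = (\<lambda>j::nat. sin (real j * \<theta>))"
  have N: "N > 0" using assms by simp
  assume "\<not> ?thesis"
  then have z: "?z < 2 * (real N - real M) + \<alpha> + 1 + 2 * \<beta> * cos \<theta>"
    by (simp add: \<beta>_def \<theta>_def)
  have \<phi>_pos: "\<phi> j > 0" if "0 < j" "j < M" for j
    unfolding \<phi>_def \<theta>_def
    by (rule sin_gt_zero) (use that in \<open>auto simp: field_simps\<close>)
  have \<phi>_nonneg: "\<phi> j \<ge> 0" if "j \<le> M" for j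
    using \<phi>_pos[of j] that assms by (cases "j = 0"; cases "j = M") (auto simp: \<phi>_def \<theta>_def)
  have \<phi>_rec: "\<phi> (Suc (Suc j)) + \<phi> j = 2 * cos \<theta> * \<phi> (Suc j)" for j
  proof -
    have "\<phi> (Suc (Suc j)) = sin (real (Suc j) * \<theta> + \<theta>)" "\<phi> j = sin (real (Suc j) * \<theta> - \<theta>)"
      by (simp_all add: \<phi>_def algebra_simps)
    then show ?thesis by (simp add: sin_add sin_diff \<phi>_def del: of_nat_Suc)
  qed
  \<comment> \<open>The weight \<open>jac_b\<close> absorbs the variation of the off-diagonal
    entries: the increment of W contains only the complete recurrences of the two sequences.\<close>
  define W where "W = (\<lambda>j. jac_b \<alpha> (N - j) * (\<phi> j * ?V (Suc j) - \<phi> (Suc j) * ?V j))"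
  have step: "W (Suc j) < W j" if "Suc j < M" for j
  proof -
    have j: "j < N" using that assms by simp
    have bs: "\<beta> \<le> jac_b \<alpha> (N - j)" "\<beta> \<le> jac_b \<alpha> (N - Suc j)"
      using jac_b_lower[OF assms(1), of "N - j"] jac_b_lower[OF assms(1), of "N - Suc j"] that assms
      by (auto simp: \<beta>_def of_nat_diff)
    have p: "\<phi> (Suc j) > 0" using that by (intro \<phi>_pos) auto
    have "(?z - (2 * real (N - j) + \<alpha> - 1)) * \<phi> (Suc j) < 2 * \<beta> * cos \<theta> * \<phi> (Suc j)"
      using z that assms p by (intro mult_strict_right_mono) (auto simp: of_nat_diff)
    also have "\<dots> = \<beta> * \<phi> (Suc (Suc j)) + \<beta> * \<phi> j"
      using arg_cong[OF \<phi>_rec[of j], of "\<lambda>t. \<beta> * t"] by (simp add: algebra_simps)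
    also have "\<dots> \<le> jac_b \<alpha> (N - Suc j) * \<phi> (Suc (Suc j)) + jac_b \<alpha> (N - j) * \<phi> j"
      using bs \<phi>_nonneg that by (intro add_mono mult_right_mono) auto
    finally have lt: "(?z - (2 * real (N - j) + \<alpha> - 1)) * \<phi> (Suc j)
        - (jac_b \<alpha> (N - Suc j) * \<phi> (Suc (Suc j)) + jac_b \<alpha> (N - j) * \<phi> j) < 0" by simp
    have "W (Suc j) - W j = \<phi> (Suc j) * (jac_b \<alpha> (N - Suc j) * ?V (Suc (Suc j)) + jac_b \<alpha> (N - j) * ?V j)
        - ?V (Suc j) * (jac_b \<alpha> (N - Suc j) * \<phi> (Suc (Suc j)) + jac_b \<alpha> (N - j) * \<phi> j)"
      by (simp add: W_def algebra_simps)
    also have "jac_b \<alpha> (N - Suc j) * ?V (Suc (Suc j)) + jac_b \<alpha> (N - j) * ?V j =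
        (?z - (2 * real (N - j) + \<alpha> - 1)) * ?V (Suc j)"
      using top_vec_rec[OF assms(1) N j] by (simp add: algebra_simps)
    also have "\<phi> (Suc j) * ((?z - (2 * real (N - j) + \<alpha> - 1)) * ?V (Suc j))
        - ?V (Suc j) * (jac_b \<alpha> (N - Suc j) * \<phi> (Suc (Suc j)) + jac_b \<alpha> (N - j) * \<phi> j) =
        ?V (Suc j) * ((?z - (2 * real (N - j) + \<alpha> - 1)) * \<phi> (Suc j)
        - (jac_b \<alpha> (N - Suc j) * \<phi> (Suc (Suc j)) + jac_b \<alpha> (N - j) * \<phi> j))"
      by (simp add: algebra_simps)
    also have "\<dots> < 0"
      by (rule mult_pos_neg[OF top_vec_pos[OF assms(1) N] lt]) (use that assms in auto)
    finally show ?thesis by simp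
  qed
  have W0: "W 0 = 0" using top_vec_0[OF assms(1) N] by (simp add: W_def \<phi>_def)
  have neg: "Suc j < M \<Longrightarrow> W (Suc j) < 0" for j
  proof (induction j)
    case 0
    then show ?case using step[of 0] W0 by simp
  next
    case (Suc j)
    then show ?case using step[of "Suc j"] by simp
  qed
  obtain m where m: "M = Suc (Suc m)" using assms(2) by (metis add_2_eq_Suc le_Suc_ex)
  have "\<phi> (Suc (Suc m)) = 0" using m assms(2) by (simp add: \<phi>_def \<theta>_def m[symmetric])
  \<comment> \<open>The sine vanishes at M, so only a product of nonnegative factors is left at
    index M - 1, contradicting the strict decrease from \<open>W 0 = 0\<close>.\<close>
  then have "W (Suc m) \<ge> 0"
    using \<phi>_pos[of "Suc m"] top_vec_pos[OF assms(1) N, of "Suc (Suc m)"] m assms(3)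
      jac_b_nonneg[OF assms(1)]
    by (simp add: W_def)
  then show False using neg[of m] m by simp
qed

lemma cos_ge_quadratic: "1 - x ^ 2 / 2 \<le> cos (x :: real)"
proof -
  have "cos x = 1 - 2 * sin (x / 2) ^ 2" using cos_double_sin[of "x / 2"] by simp
  moreover have "sin (x / 2) ^ 2 \<le> (x / 2) ^ 2"
    using abs_sin_x_le_abs_x[of "x / 2"] by (metis abs_le_square_iff)
  ultimately show ?thesis by (simp add: power2_eq_square)
qed

text \<open>Comparing on M rows costs a multiple of M from the decreasing entries and a multiple of
  N / M^2 from the cosine. The two balance at M of order N^(1/3).\<close>

lemma largest_laguerre_zero_lower:
  assumes "\<alpha> > -1"
  shows "eventually (\<lambda>N. largest_laguerre_zero \<alpha> N \<ge>
    4 * real N - (32 + 3 * \<bar>\<alpha>\<bar>) * real N powr (1/3)) sequentially"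
proof -
  have "eventually (\<lambda>N. real N powr (1/3) \<ge> 1) sequentially"
    "eventually (\<lambda>N. real N - (real N powr (1/3) + 3) - \<bar>\<alpha>\<bar> \<ge> 0) sequentially"
    by real_asymp+
  then show ?thesis using eventually_gt_at_top[of 0]
  proof eventually_elim
    case (elim N)
    define t where "t = real N powr (1/3)"
    define M where "M = nat \<lceil>t\<rceil> + 2"
    have t: "t \<ge> 1" "real N = t ^ 3"
      using elim by (auto simp: t_def powr_realpow[symmetric] powr_powr)
    have M: "t \<le> real M" "real M \<le> t + 3" "2 \<le> M" using t(1) by (auto simp: M_def) linarith+
    have \<beta>: "real N - real M - \<bar>\<alpha>\<bar> \<ge> 0" using elim M by (simp add: t_def)
    then have "M \<le> N" by linarith
    define \<theta> where "\<theta> = pi / real M"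
    have "\<theta> \<le> 4 / t" unfolding \<theta>_def using M t pi_less_4 by (intro frac_le) auto
    then have "\<theta> ^ 2 \<le> (4 / t) ^ 2" by (intro power_mono) (auto simp: \<theta>_def)
    then have \<theta>2: "real N * \<theta> ^ 2 \<le> 16 * t"
      using t mult_left_mono[of "\<theta>\<^sup>2" "(4/t)\<^sup>2" "t ^ 3"] by (simp add: power2_eq_square power3_eq_cube field_simps)
    have "largest_laguerre_zero \<alpha> N \<ge>
        2 * (real N - real M) + \<alpha> + 1 + 2 * (real N - real M - \<bar>\<alpha>\<bar>) * cos \<theta>"
      unfolding \<theta>_def by (rule largest_laguerre_zero_lower_aux[OF assms(1) M(3) \<open>M \<le> N\<close> \<beta>])
    moreover have "(real N - real M - \<bar>\<alpha>\<bar>) * cos \<theta> \<ge> (real N - real M - \<bar>\<alpha>\<bar>) - 8 * t"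
    proof -
      have "(real N - real M - \<bar>\<alpha>\<bar>) * cos \<theta> \<ge> (real N - real M - \<bar>\<alpha>\<bar>) * (1 - \<theta>\<^sup>2 / 2)"
        using cos_ge_quadratic \<beta> by (intro mult_left_mono)
      moreover have "(real N - real M - \<bar>\<alpha>\<bar>) * \<theta>\<^sup>2 \<le> real N * \<theta>\<^sup>2"
        by (intro mult_right_mono) auto
      ultimately show ?thesis using \<theta>2 unfolding right_diff_distrib by simp
    qed
    \<comment> \<open>The losses are 4 M, at most 4 t + 12, then 16 t from the cosine, and at most 3
      |\<alpha>|; t \<ge> 1 absorbs the constants into multiples of t.\<close>
    moreover have "(32 + 3 * \<bar>\<alpha>\<bar>) * t \<ge> 32 * t + 3 * \<bar>\<alpha>\<bar>"
      using t(1) mult_left_mono[of 1 t "\<bar>\<alpha>\<bar>"] by (simp add: algebra_simps)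
    ultimately show ?case using M(2) t(1) unfolding t_def[symmetric] by argo
  qed
qed

section \<open>The Airy equation\<close>

text \<open>The derivative is a second argument, so that solutions can be combined and
  differentiated without \<open>deriv\<close>.\<close>

definition airy_sol :: "(real \<Rightarrow> real) \<Rightarrow> (real \<Rightarrow> real) \<Rightarrow> bool" where
  "airy_sol y y' \<longleftrightarrow>
     (\<forall>z. (y has_real_derivative y' z) (at z) \<and> (y' has_real_derivative z * y z) (at z))"

lemma airy_solD:
  assumes "airy_sol y y'"
  shows "(y has_real_derivative y' z) (at z within S)" "(y' has_real_derivative z * y z) (at z within S)"
  using assms unfolding airy_sol_def by (auto intro: has_field_derivative_at_within)

text \<open>Taylor coefficients at 0 of the solution with value a and slope b there, from matching
  powers in y'' = z y.\<close>

fun airy_coeff :: "real \<Rightarrow> real \<Rightarrow> nat \<Rightarrow> real" where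
  "airy_coeff a b 0 = a"
| "airy_coeff a b (Suc 0) = b"
| "airy_coeff a b (Suc (Suc 0)) = 0"
| "airy_coeff a b (Suc (Suc (Suc n))) = airy_coeff a b n / (real (n + 2) * real (n + 3))"

text \<open>With X = |x| + 1 the terms c_n X^n stay bounded: three indices further the modulus is
  multiplied by X^3 / ((m+2) (m+3)), at most 1 for large m. A geometric series of ratio |x| / X then
  dominates.\<close>

lemma summable_airy_coeff: "summable (\<lambda>n. airy_coeff a b n * x ^ n)"
proof -
  define c where "c = airy_coeff a b"
  define X where "X = \<bar>x\<bar> + 1"
  have "X > 0" by (simp add: X_def)
  obtain K where K: "real K \<ge> X ^ 3" using real_arch_simple by blast
  define B where "B = Max ((\<lambda>n. \<bar>c n * X ^ n\<bar>) ` {..K + 2})"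
  have bound: "\<bar>c n * X ^ n\<bar> \<le> B" for n
  proof (induction n rule: less_induct)
    case (less n)
    show ?case
    proof (cases "n \<le> K + 2")
      case True
      then show ?thesis unfolding B_def by (intro Max_ge) auto
    next
      case False
      then obtain m where m: "n = Suc (Suc (Suc m))" "m \<ge> K"
        by (metis Suc_le_mono add_2_eq_Suc' not_less_eq_eq Suc_le_D)
      have "X ^ 3 \<le> real (m + 2) * real (m + 3)"
      proof -
        have "X ^ 3 \<le> real m * 1" using K m(2) by simp
        also have "\<dots> \<le> real (m + 2) * real (m + 3)" by (intro mult_mono) auto
        finally show ?thesis .
      qed
      then have r: "X ^ 3 / (real (m + 2) * real (m + 3)) \<le> 1"
        by (simp add: divide_simps del: of_nat_add)
      have "\<bar>c n * X ^ n\<bar> = \<bar>c m * X ^ m\<bar> * (X ^ 3 / (real (m + 2) * real (m + 3)))"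
        using \<open>X > 0\<close> by (simp add: c_def m abs_mult power3_eq_cube mult_ac)
      also have "\<dots> \<le> \<bar>c m * X ^ m\<bar> * 1"
        using r by (intro mult_left_mono) auto
      also have "\<dots> \<le> B" using less[of m] m by simp
      finally show ?thesis .
    qed
  qed
  define r where "r = \<bar>x\<bar> / X"
  have r: "0 \<le> r" "r < 1" by (auto simp: r_def X_def)
  have "summable (\<lambda>n. B * r ^ n)"
    using r by (intro summable_mult summable_geometric) auto
  moreover have "norm (c n * x ^ n) \<le> B * r ^ n" for n
  proof -
    have "norm (c n * x ^ n) = \<bar>c n * X ^ n\<bar> * r ^ n"
      using \<open>X > 0\<close> by (simp add: r_def abs_mult power_abs power_divide)
    also have "\<dots> \<le> B * r ^ n" using bound r by (intro mult_right_mono) auto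
    finally show ?thesis .
  qed
  ultimately show ?thesis unfolding c_def
    by (rule summable_comparison_test'[where N = 0])
qed

lemma airy_sol_exists: "\<exists>y y'. airy_sol y y' \<and> y 0 = a \<and> y' 0 = b"
proof -
  define c where "c = airy_coeff a b"
  have s0: "summable (\<lambda>n. c n * x ^ n)" for x
    unfolding c_def by (rule summable_airy_coeff)
  have s1: "summable (\<lambda>n. diffs c n * x ^ n)" for x
    by (rule termdiff_converges_all[OF s0])
  have s2: "summable (\<lambda>n. diffs (diffs c) n * x ^ n)" for x
    by (rule termdiff_converges_all[OF s1])
  define y y' where "y = (\<lambda>x. \<Sum>n. c n * x ^ n)" and "y' = (\<lambda>x. \<Sum>n. diffs c n * x ^ n)"
  have "(\<Sum>n. diffs (diffs c) n * x ^ n) = x * y x" for x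
  proof -
    have "diffs (diffs c) (Suc n) = c n" for n
      by (simp add: diffs_def c_def divide_simps)
    moreover have "diffs (diffs c) 0 = 0"
      by (simp add: diffs_def c_def)
    ultimately have "(\<Sum>n. diffs (diffs c) n * x ^ n) = (\<Sum>n. x * (c n * x ^ n))"
      using suminf_split_head[OF s2, of x] by (simp add: mult_ac)
    then show ?thesis using suminf_mult[OF s0] by (simp add: y_def)
  qed
  then have "airy_sol y y'"
    unfolding airy_sol_def
    using termdiffs_strong_converges_everywhere[OF s0] termdiffs_strong_converges_everywhere[OF s1]
    by (simp add: y_def y'_def)
  moreover have "y 0 = a" "y' 0 = b"
    by (simp_all add: y_def y'_def powser_zero c_def diffs_def)
  ultimately show ?thesis by blast
qed

lemma airy_sol_lincomb:
  assumes "airy_sol u u'" "airy_sol v v'"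
  shows "airy_sol (\<lambda>z. a * u z + b * v z) (\<lambda>z. a * u' z + b * v' z)"
  unfolding airy_sol_def
  by (auto intro!: derivative_eq_intros airy_solD[OF assms(1)] airy_solD[OF assms(2)] simp: algebra_simps)

lemma airy_wronskian_const:
  assumes "airy_sol u u'" "airy_sol v v'"
  shows "u z * v' z - u' z * v z = u t * v' t - u' t * v t"
proof -
  have "\<forall>z. ((\<lambda>z. u z * v' z - u' z * v z) has_real_derivative 0) (at z)"
    by (auto intro!: derivative_eq_intros airy_solD[OF assms(1)] airy_solD[OF assms(2)] simp: algebra_simps)
  from DERIV_isconst_all[OF this, of z t] show ?thesis .
qed

text \<open>Uniqueness for the initial value problem without Gronwall: the Wronskians of w with two
  fundamental solutions are 0, and the Wronskian of those two is 1.\<close>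

lemma airy_sol_zero:
  assumes w: "airy_sol w w'" and "w t = 0" "w' t = 0"
  shows "w z = 0" "w' z = 0"
proof -
  obtain A A' where A: "airy_sol A A'" "A 0 = 1" "A' 0 = 0"
    using airy_sol_exists by blast
  obtain B B' where B: "airy_sol B B'" "B 0 = 0" "B' 0 = 1"
    using airy_sol_exists by blast
  have AB: "A z * B' z - A' z * B z = 1"
    using airy_wronskian_const[OF A(1) B(1), of z 0] A B by simp
  have 1: "w z * A' z = w' z * A z" and 2: "w z * B' z = w' z * B z"
    using airy_wronskian_const[OF w A(1), of z t] airy_wronskian_const[OF w B(1), of z t] assms by auto
  have "w z = A z * (w z * B' z) - B z * (w z * A' z)"
    using arg_cong[OF AB, of "\<lambda>s. w z * s"] by (simp add: algebra_simps)
  then show "w z = 0" unfolding 1 2 by simp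
  have "w' z = B' z * (w' z * A z) - A' z * (w' z * B z)"
    using arg_cong[OF AB, of "\<lambda>s. w' z * s"] by (simp add: algebra_simps)
  then show "w' z = 0" unfolding 1[symmetric] 2[symmetric] by simp
qed

text \<open>Solutions are first built from data at 0. The combination -c B(s) A + c A(s) B vanishes
  at s, and its slope there is c times the Wronskian 1.\<close>

lemma airy_sol_exists_at:
  obtains y y' where "airy_sol y y'" "y s = 0" "y' s = c"
proof -
  obtain A A' where A: "airy_sol A A'" "A 0 = 1" "A' 0 = 0"
    using airy_sol_exists by blast
  obtain B B' where B: "airy_sol B B'" "B 0 = 0" "B' 0 = 1"
    using airy_sol_exists by blast
  have "A s * B' s - A' s * B s = 1"
    using airy_wronskian_const[OF A(1) B(1), of s 0] A B by simp
  from arg_cong[OF this, of "\<lambda>s. c * s"]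
  have "- c * B s * A' s + c * A s * B' s = c" by (simp add: algebra_simps)
  then show thesis
    using that[OF airy_sol_lincomb[OF A(1) B(1), of "- c * B s" "c * A s"]] by simp
qed

text \<open>\<open>(y\<^sup>2)' = 2 y y'\<close> and \<open>(y y')' = y'\<^sup>2 + z y\<^sup>2 \<ge> 0\<close> for \<open>z \<ge> 0\<close>, so \<open>y\<^sup>2\<close> increases from \<open>0\<close>.\<close>

lemma decaying_airy_sol_zero:
  assumes y: "airy_sol y y'" and lim: "(y \<longlongrightarrow> 0) at_top" and 0: "y 0 = 0"
  shows "y z = 0"
proof -
  have prod: "y z * y' z \<ge> 0" if "z \<ge> 0" for z
  proof -
    have "(\<lambda>z. y z * y' z) 0 \<le> (\<lambda>z. y z * y' z) z"
    proof (rule DERIV_nonneg_imp_nondecreasing[OF that])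
      fix x :: real assume "0 \<le> x"
      then show "\<exists>D. ((\<lambda>z. y z * y' z) has_real_derivative D) (at x) \<and> D \<ge> 0"
        by (intro exI[of _ "y' x ^ 2 + x * y x ^ 2"])
          (auto intro!: derivative_eq_intros airy_solD[OF y] simp: power2_eq_square)
    qed
    then show ?thesis using 0 by simp
  qed
  have mono: "y s ^ 2 \<le> y t ^ 2" if "0 \<le> s" "s \<le> t" for s t
  proof (rule DERIV_nonneg_imp_nondecreasing[OF that(2)])
    fix x :: real assume "s \<le> x"
    then show "\<exists>D. ((\<lambda>z. y z ^ 2) has_real_derivative D) (at x) \<and> D \<ge> 0"
      using prod[of x] that(1)
      by (intro exI[of _ "2 * (y x * y' x)"]) (auto intro!: derivative_eq_intros airy_solD[OF y])
  qed
  have zero: "y s = 0" if "s \<ge> 0" for s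
  proof -
    have "((\<lambda>z. y z ^ 2) \<longlongrightarrow> 0 ^ 2) at_top" by (intro tendsto_power lim)
    moreover have "eventually (\<lambda>t. y s ^ 2 \<le> y t ^ 2) at_top"
      using eventually_ge_at_top[of s] by eventually_elim (rule mono[OF that])
    ultimately have "y s ^ 2 \<le> 0 ^ 2"
      by (intro tendsto_lowerbound) auto
    then show ?thesis by simp
  qed
  \<comment> \<open>So far y vanishes on the half-line only. The data at the interior point 1 are
    zero, and uniqueness extends this to all z.\<close>
  have "y' 1 = 0"
  proof (rule DERIV_local_min[OF airy_solD(1)[OF y, of 1 UNIV]])
    show "\<forall>x. \<bar>1 - x\<bar> < 1 \<longrightarrow> y 1 \<le> y x" using zero by auto
  qed simp
  then show ?thesis using airy_sol_zero(1)[OF y, of 1] zero[of 1] by simp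
qed

section \<open>Identification of the Airy function and its largest zero\<close>

lemma is_airy_airy_sol: "is_airy y \<Longrightarrow> airy_sol y (deriv y)"
  unfolding is_airy_def airy_sol_def
  by (auto simp: DERIV_deriv_iff_real_differentiable)

text \<open>Resolves the \<open>THE\<close>: a nontrivial decaying H has H 0 \<noteq> 0, so it can
  be scaled to the prescribed value at 0, and the difference of two candidates decays and vanishes
  at 0. Existence of \<open>airy_Ai\<close> thus reduces to supplying such an H.\<close>

lemma airy_Ai_decaying:
  assumes H: "airy_sol H H'" and lim: "(H \<longlongrightarrow> 0) at_top" and nz: "H s \<noteq> 0 \<or> H' s \<noteq> 0"
  obtains C where "C \<noteq> 0" "airy_Ai = (\<lambda>z. C * H z)"
proof -
  define c :: real where "c = 1 / (3 powr (2/3) * Gamma (2/3))"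
  have "Gamma (2/3 :: real) > 0" by (rule Gamma_real_pos) simp
  then have "c > 0" by (simp add: c_def)
  have "H 0 \<noteq> 0"
  proof
    assume "H 0 = 0"
    then have z: "H z = 0" for z using decaying_airy_sol_zero[OF H lim] by simp
    have "H' s = 0"
      by (rule DERIV_local_min[OF airy_solD(1)[OF H, of s UNIV], of 1]) (simp_all add: z)
    with z nz show False by simp
  qed
  define C where "C = c / H 0"
  have sol: "airy_sol (\<lambda>z. C * H z) (\<lambda>z. C * H' z)"
    using airy_sol_lincomb[OF H H, of C 0] by simp
  have lim': "((\<lambda>z. C * H z) \<longlongrightarrow> 0) at_top" using tendsto_mult_left[OF lim, of C] by simp
  have val: "C * H 0 = c" using \<open>H 0 \<noteq> 0\<close> by (simp add: C_def)
  have d: "deriv (\<lambda>z. C * H z) = (\<lambda>z. C * H' z)"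
    using sol unfolding airy_sol_def by (intro ext DERIV_imp_deriv) auto
  have "is_airy (\<lambda>z. C * H z)"
    unfolding is_airy_def d using sol lim' val unfolding airy_sol_def
    by (auto simp: c_def real_differentiable_def)
  moreover have "y = (\<lambda>z. C * H z)" if "is_airy y" for y
  proof
    fix z
    have "(\<lambda>z. 1 * y z + (- 1) * (C * H z)) z = 0"
    proof (rule decaying_airy_sol_zero[OF airy_sol_lincomb[OF is_airy_airy_sol[OF that] sol]])
      have "(y \<longlongrightarrow> 0) at_top" using that by (simp add: is_airy_def)
      then show "((\<lambda>z. 1 * y z + (- 1) * (C * H z)) \<longlongrightarrow> 0) at_top"
        using tendsto_diff[OF _ lim', of y 0] by simp
      show "1 * y 0 + (- 1) * (C * H 0) = 0" using that val by (simp add: is_airy_def c_def)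
    qed
    then show "y z = C * H z" by simp
  qed
  ultimately have "airy_Ai = (\<lambda>z. C * H z)"
    unfolding airy_Ai_def by (rule the_equality)
  moreover have "C \<noteq> 0" using \<open>c > 0\<close> \<open>H 0 \<noteq> 0\<close> by (simp add: C_def)
  ultimately show thesis using that by blast
qed

text \<open>A nonnegative nonincreasing H has slope at most K in modulus somewhere in each unit
  interval. Between two such points at least 1 apart, H' changes by at most 2 K, while H'' = x H is
  at least t H(t+3). Hence H(t+3) \<le> 2 K / t.\<close>

lemma airy_sol_decays:
  assumes H: "airy_sol H H'" and nonneg: "\<And>t. t \<ge> t0 \<Longrightarrow> H t \<ge> 0"
    and anti: "\<And>s t. t0 \<le> s \<Longrightarrow> s \<le> t \<Longrightarrow> H t \<le> H s"
  shows "(H \<longlongrightarrow> 0) at_top"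
proof -
  define K where "K = H t0"
  have slope: "\<exists>x. s < x \<and> x < s + 1 \<and> \<bar>H' x\<bar> \<le> K" if "s \<ge> t0" for s
  proof -
    obtain x where x: "s < x" "x < s + 1" "H (s + 1) - H s = (s + 1 - s) * H' x"
      using MVT2[of s "s + 1" H H'] airy_solD(1)[OF H, where S = UNIV] by auto
    then have "H' x = H (s + 1) - H s" by simp
    moreover have "0 \<le> H (s + 1)" "H (s + 1) \<le> H s" "H s \<le> K"
      using nonneg anti that by (auto simp: K_def)
    ultimately show ?thesis using x by (intro exI[of _ x]) auto
  qed
  have bound: "H (t + 3) \<le> 2 * K / t" if t: "t \<ge> t0" "t > 0" for t
  proof -
    obtain x1 where x1: "t < x1" "x1 < t + 1" "\<bar>H' x1\<bar> \<le> K" using slope[of t] t by auto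
    obtain x2 where x2: "t + 2 < x2" "x2 < t + 2 + 1" "\<bar>H' x2\<bar> \<le> K" using slope[of "t + 2"] t by auto
    obtain x where x: "x1 < x" "x < x2" "H' x2 - H' x1 = (x2 - x1) * (x * H x)"
      using MVT2[of x1 x2 H' "\<lambda>z. z * H z"] airy_solD(2)[OF H, where S = UNIV] x1 x2 by auto
    have le: "t * H (t + 3) \<le> x * H x"
      using t x x1 x2 nonneg anti by (intro mult_mono) auto
    have "t * H (t + 3) \<ge> 0" using t nonneg by simp
    with le have "1 * (t * H (t + 3)) \<le> (x2 - x1) * (x * H x)"
      using x1 x2 order_trans[OF _ le] by (intro mult_mono[OF _ le]) auto
    also have "\<dots> \<le> 2 * K" using x(3) x1(3) x2(3) by linarith
    finally show ?thesis using t by (simp add: field_simps)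
  qed
  have "((\<lambda>t. H (t + 3)) \<longlongrightarrow> 0) at_top"
  proof (rule tendsto_sandwich)
    show "eventually (\<lambda>t. 0 \<le> H (t + 3)) at_top"
      using eventually_ge_at_top[of t0] by eventually_elim (auto intro: nonneg)
    show "eventually (\<lambda>t. H (t + 3) \<le> 2 * K / t) at_top"
      using eventually_ge_at_top[of t0] eventually_gt_at_top[of 0]
      by eventually_elim (rule bound)
    show "((\<lambda>t. 2 * K / t) \<longlongrightarrow> 0) at_top"
      by (rule real_tendsto_divide_at_top[OF tendsto_const filterlim_ident])
  qed simp
  then show ?thesis
    using filterlim_compose[of "\<lambda>t. H (t + 3)" "nhds 0" at_top "\<lambda>t. t + (- 3)" at_top]
      filterlim_tendsto_add_at_top[OF tendsto_const[of "- 3"] filterlim_ident]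
    by (simp add: add.commute)
qed

text \<open>A zero beyond s would be an interior minimum, hence a double zero, and H would vanish
  identically. The quotient by the slope at s does not see the constant that relates H to
  \<open>airy_Ai\<close>.\<close>

lemma airy_ground_state:
  assumes H: "airy_sol H H'" and s: "H s = 0" "H' s \<noteq> 0"
    and nonneg: "\<And>t. t \<ge> s \<Longrightarrow> H t \<ge> 0"
    and anti: "\<And>u v. t0 \<le> u \<Longrightarrow> u \<le> v \<Longrightarrow> H v \<le> H u"
  shows "airy_a1 = s" "airy_Ai t / deriv airy_Ai airy_a1 = H t / H' s"
proof -
  have "(H \<longlongrightarrow> 0) at_top"
    by (rule airy_sol_decays[OF H, of "max s t0"]) (auto intro: nonneg anti)
  then obtain C where C: "C \<noteq> 0" "airy_Ai = (\<lambda>z. C * H z)"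
    using airy_Ai_decaying[OF H] s(2) by blast
  show a1: "airy_a1 = s"
    unfolding airy_a1_def
  proof (rule Greatest_equality)
    show "airy_Ai s = 0" by (simp add: C s)
    fix t assume "airy_Ai t = 0"
    then have "H t = 0" using C(1) unfolding C(2) by simp
    show "t \<le> s"
    proof (rule ccontr)
      assume "\<not> t \<le> s"
      then have "H' t = 0"
        using \<open>H t = 0\<close> nonneg by (intro DERIV_local_min[OF airy_solD(1)[OF H, of t UNIV], of "t - s"]) auto
      then show False using airy_sol_zero(2)[OF H \<open>H t = 0\<close>] s(2) by simp
    qed
  qed
  have "(airy_Ai has_real_derivative C * H' s) (at s)"
    unfolding C(2) by (intro DERIV_cmult airy_solD(1)[OF H])
  then have "deriv airy_Ai s = C * H' s" by (rule DERIV_imp_deriv)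
  then show "airy_Ai t / deriv airy_Ai airy_a1 = H t / H' s"
    using C(1) unfolding a1 by (simp add: C(2))
qed

section \<open>The scaling limit\<close>

text \<open>Discrete Gronwall estimate for F and its difference quotient d. Here \<kappa> bounds the
  truncation error per step length, and \<epsilon> the errors of the coefficients. One step
  multiplies the total error by at most 1 + (C+3) h: C + 2 comes from the right-hand side of the
  equation and 1 from the update of F.\<close>

lemma euler_error:
  fixes F d q s :: "nat \<Rightarrow> real" and G G' Q :: "real \<Rightarrow> real"
  assumes h: "0 < h" "h \<le> 1" and \<epsilon>: "0 \<le> \<epsilon>" "\<epsilon> \<le> 1" and nonneg: "0 \<le> C" "0 \<le> \<kappa>" "0 \<le> M"
    and F: "\<And>j. j < J \<Longrightarrow> F (Suc j) = F j + h * d j"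
    and d: "\<And>j. j < J \<Longrightarrow> d (Suc j) = d j + h * (q j * F (Suc j) + s j * d j)"
    and q: "\<And>j. j < J \<Longrightarrow> \<bar>q j - Q (real (Suc j) * h)\<bar> \<le> \<epsilon>"
    and s: "\<And>j. j < J \<Longrightarrow> \<bar>s j\<bar> \<le> \<epsilon>"
    and G: "\<And>j. j < J \<Longrightarrow> \<bar>G (real (Suc j) * h) - G (real j * h) - h * G' (real j * h)\<bar> \<le> h * \<kappa>"
    and G': "\<And>j. j < J \<Longrightarrow> \<bar>G' (real (Suc j) * h) - G' (real j * h)
        - h * (Q (real (Suc j) * h) * G (real (Suc j) * h))\<bar> \<le> h * \<kappa>"
    and bounds: "\<And>j. j < J \<Longrightarrow> \<bar>Q (real (Suc j) * h)\<bar> \<le> C"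
      "\<And>j. j < J \<Longrightarrow> \<bar>G (real (Suc j) * h)\<bar> \<le> M" "\<And>j. j < J \<Longrightarrow> \<bar>G' (real j * h)\<bar> \<le> M"
    and "j \<le> J"
  shows "\<bar>F j - G (real j * h)\<bar> + \<bar>d j - G' (real j * h)\<bar> \<le>
    (\<bar>F 0 - G 0\<bar> + \<bar>d 0 - G' 0\<bar> + real j * h * ((C + 3) * \<kappa> + 2 * \<epsilon> * M)) * exp ((C + 3) * h) ^ j"
  using \<open>j \<le> J\<close>
proof (induction j)
  case (Suc j)
  define e \<delta> where "e = (\<lambda>j. F j - G (real j * h))" and "\<delta> = (\<lambda>j. d j - G' (real j * h))"
  define \<eta> where "\<eta> = (C + 3) * \<kappa> + 2 * \<epsilon> * M"
  define T where "T = \<bar>e j\<bar> + \<bar>\<delta> j\<bar>"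
  define g Qj where "g = G (real (Suc j) * h)" and "Qj = Q (real (Suc j) * h)"
  have j: "j < J" using Suc by simp
  have T0: "T \<ge> 0" by (simp add: T_def)
  have "e (Suc j) = e j + h * \<delta> j - (g - G (real j * h) - h * G' (real j * h))"
    unfolding e_def \<delta>_def g_def F[OF j] by (simp add: algebra_simps)
  then have e: "\<bar>e (Suc j)\<bar> \<le> \<bar>e j\<bar> + h * \<bar>\<delta> j\<bar> + h * \<kappa>"
    using G[OF j] h abs_mult[of h "\<delta> j"] unfolding g_def by linarith
  also have "h * \<bar>\<delta> j\<bar> \<le> 1 * \<bar>\<delta> j\<bar>" using h by (intro mult_right_mono) auto
  also have "h * \<kappa> \<le> 1 * \<kappa>" using h nonneg by (intro mult_right_mono) auto
  \<comment> \<open>The scheme evaluates F at the new index, so the new error of F is first bounded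
    crudely by old quantities.\<close>
  finally have e': "\<bar>e (Suc j)\<bar> \<le> T + \<kappa>" by (simp add: T_def)
  define r where "r = q j * F (Suc j) + s j * d j - Qj * g"
  have "r = q j * e (Suc j) + (q j - Qj) * g + s j * \<delta> j + s j * G' (real j * h)"
    by (simp add: r_def e_def \<delta>_def g_def algebra_simps)
  then have "\<bar>r\<bar> \<le> \<bar>q j\<bar> * \<bar>e (Suc j)\<bar> + \<bar>q j - Qj\<bar> * \<bar>g\<bar> + \<bar>s j\<bar> * \<bar>\<delta> j\<bar> + \<bar>s j\<bar> * \<bar>G' (real j * h)\<bar>"
    unfolding abs_mult[symmetric] by linarith
  also have "\<dots> \<le> (C + 1) * (T + \<kappa>) + \<epsilon> * M + 1 * T + \<epsilon> * M"
  proof (intro add_mono mult_mono)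
    show "\<bar>q j\<bar> \<le> C + 1" using q[OF j] bounds(1)[OF j] \<epsilon> by linarith
    show "\<bar>s j\<bar> \<le> 1" using s[OF j] \<epsilon> by linarith
    show "\<bar>\<delta> j\<bar> \<le> T" by (simp add: T_def)
  qed (use e' q[OF j] s[OF j] bounds(2,3)[OF j] nonneg \<epsilon> T0 in \<open>auto simp: Qj_def g_def\<close>)
  finally have r: "\<bar>r\<bar> \<le> (C + 2) * T + (C + 1) * \<kappa> + 2 * \<epsilon> * M" by (simp add: algebra_simps)
  have "\<delta> (Suc j) = \<delta> j + h * r - (G' (real (Suc j) * h) - G' (real j * h) - h * (Qj * g))"
    unfolding \<delta>_def r_def d[OF j] by (simp add: algebra_simps)
  then have "\<bar>\<delta> (Suc j)\<bar> \<le> \<bar>\<delta> j\<bar> + h * \<bar>r\<bar> + h * \<kappa>"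
    using G'[OF j] h abs_mult[of h r] unfolding g_def Qj_def by linarith
  also have "h * \<bar>r\<bar> \<le> h * ((C + 2) * T + (C + 1) * \<kappa> + 2 * \<epsilon> * M)"
    using r h by (intro mult_left_mono) auto
  finally have \<delta>: "\<bar>\<delta> (Suc j)\<bar> \<le> \<bar>\<delta> j\<bar> + h * ((C + 2) * T + (C + 1) * \<kappa> + 2 * \<epsilon> * M) + h * \<kappa>"
    by simp
  have "h * \<bar>\<delta> j\<bar> \<le> h * T" using h by (intro mult_left_mono) (auto simp: T_def)
  with e \<delta> have step: "\<bar>e (Suc j)\<bar> + \<bar>\<delta> (Suc j)\<bar> \<le> T * (1 + (C + 3) * h) + h * \<eta>"
    by (simp add: T_def \<eta>_def algebra_simps)
  define E where "E = exp ((C + 3) * h)"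
  define S where "S = \<bar>F 0 - G 0\<bar> + \<bar>d 0 - G' 0\<bar> + real j * h * \<eta>"
  have E: "1 + (C + 3) * h \<le> E" "1 \<le> E" unfolding E_def using h nonneg by (auto intro: exp_ge_add_one_self)
  have \<eta>: "\<eta> \<ge> 0" using nonneg \<epsilon> by (simp add: \<eta>_def)
  have IH: "T \<le> S * E ^ j"
    using Suc.IH j by (simp add: T_def e_def \<delta>_def S_def E_def \<eta>_def)
  have "T * (1 + (C + 3) * h) \<le> (S * E ^ j) * E"
    using IH E T0 h nonneg by (intro mult_mono) (auto intro: order_trans[OF T0])
  moreover have "h * \<eta> * 1 \<le> h * \<eta> * E ^ Suc j"
    using h \<eta> one_le_power[OF E(2), of "Suc j"] by (intro mult_left_mono) auto
  ultimately have "\<bar>e (Suc j)\<bar> + \<bar>\<delta> (Suc j)\<bar> \<le> (S + h * \<eta>) * E ^ Suc j"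
    using step by (simp add: algebra_simps)
  then show ?case
    by (simp add: e_def \<delta>_def S_def E_def \<eta>_def algebra_simps)
qed simp

text \<open>The \<mu> of the overview: distance of the largest zero from 4 N on the scale
  N^(1/3).\<close>

abbreviation lag_defect :: "real \<Rightarrow> nat \<Rightarrow> real" where
  "lag_defect \<alpha> N \<equiv> (4 * real N - largest_laguerre_zero \<alpha> N) / real N powr (1/3)"

text \<open>Bounds for the zeroth- and first-order coefficients of the rescaled second-difference
  equation. D is a lower bound for the divisor b0 on the range of j considered.\<close>

lemma scaled_coefficient_estimates:
  assumes \<alpha>: "\<alpha> > -1" and N: "N > 0" and j: "real (Suc j) \<le> Y * t"
    and t: "t \<ge> 1" "t ^ 3 = real N" and D: "D = real N - Y * t - \<bar>\<alpha>\<bar>" "D > 0"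
    and z: "z = 4 * real N - \<mu> * t"
  defines "b0 \<equiv> jac_b \<alpha> (N - Suc j)" and "b1 \<equiv> jac_b \<alpha> (N - j)"
  shows "b0 > 0"
    and "\<bar>t ^ 2 * (z - (2 * real (N - j) + \<alpha> - 1) - b0 - b1) / b0 - (4 * (real (Suc j) / t) - m)\<bar>
      \<le> (Y * t + \<bar>\<alpha>\<bar>) / D * (4 * Y + \<bar>\<mu>\<bar> + (3 * \<bar>\<alpha>\<bar> + 2) / t) + \<bar>\<mu> - m\<bar> + (3 * \<bar>\<alpha>\<bar> + 2) / t"
    and "\<bar>t * (b1 - b0) / b0\<bar> \<le> t * (1 + 2 * \<bar>\<alpha>\<bar>) / D"
proof -
  have lt: "Suc j < N" using D j by linarith
  have b: "\<bar>b0 - (real N - real (Suc j))\<bar> \<le> \<bar>\<alpha>\<bar>" "\<bar>b1 - (real N - real j)\<bar> \<le> \<bar>\<alpha>\<bar>"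
    using jac_b_lower[OF \<alpha>, of "N - Suc j"] jac_b_upper[OF \<alpha>, of "N - Suc j"]
      jac_b_lower[OF \<alpha>, of "N - j"] jac_b_upper[OF \<alpha>, of "N - j"] of_nat_diff[of "Suc j" N, where ?'a = real]
      of_nat_diff[of j N, where ?'a = real] lt
    unfolding b0_def b1_def by linarith+
  have b0D: "b0 \<ge> D" using b j D by linarith
  then show b0: "b0 > 0" using D by linarith
  have "\<bar>b1 - b0\<bar> \<le> 1 + 2 * \<bar>\<alpha>\<bar>" using b by simp
  then have "\<bar>b1 - b0\<bar> / b0 \<le> (1 + 2 * \<bar>\<alpha>\<bar>) / D"
    using b0D D by (intro frac_le) auto
  then have "t * (\<bar>b1 - b0\<bar> / b0) \<le> t * ((1 + 2 * \<bar>\<alpha>\<bar>) / D)"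
    using t by (intro mult_left_mono) auto
  then show "\<bar>t * (b1 - b0) / b0\<bar> \<le> t * (1 + 2 * \<bar>\<alpha>\<bar>) / D"
    using t b0 by (simp add: abs_mult)
  \<comment> \<open>What is left after the main terms cancel: \<alpha>, the deviations of two
    off-diagonal entries (at most |\<alpha>| each), and the integer -2.\<close>
  define \<rho> where "\<rho> = z - (2 * real (N - j) + \<alpha> - 1) - b0 - b1 - (4 * real (Suc j) - \<mu> * t)"
  have \<rho>: "\<bar>\<rho>\<bar> \<le> 3 * \<bar>\<alpha>\<bar> + 2"
    using b lt by (simp add: \<rho>_def z of_nat_diff)
  define w where "w = 4 * (real (Suc j) / t) - \<mu> + \<rho> / t"
  have t0: "t > 0" using t by simp
  have w: "\<bar>w\<bar> \<le> 4 * Y + \<bar>\<mu>\<bar> + (3 * \<bar>\<alpha>\<bar> + 2) / t"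
  proof -
    have "real (Suc j) / t \<le> Y" using j t0 by (simp add: divide_le_eq del: of_nat_Suc)
    moreover have "\<bar>\<rho> / t\<bar> \<le> (3 * \<bar>\<alpha>\<bar> + 2) / t" using \<rho> t0 by (simp add: divide_right_mono)
    moreover have "real (Suc j) / t \<ge> 0" using t0 by simp
    ultimately show ?thesis unfolding w_def by linarith
  qed
  have "z - (2 * real (N - j) + \<alpha> - 1) - b0 - b1 = t * w"
    using t0 unfolding w_def \<rho>_def by (simp add: field_simps)
  then have "t ^ 2 * (z - (2 * real (N - j) + \<alpha> - 1) - b0 - b1) / b0 = real N / b0 * w"
    by (simp add: t(2)[symmetric] power2_eq_square power3_eq_cube)
  \<comment> \<open>Scaling gives N / b0 instead of 1; the excess (N - b0) / b0 is of order
    N^(-2/3).\<close>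
  also have "\<dots> = (real N - b0) / b0 * w + w"
    using b0 by (simp add: field_simps)
  finally have eq: "t ^ 2 * (z - (2 * real (N - j) + \<alpha> - 1) - b0 - b1) / b0 - (4 * (real (Suc j) / t) - m)
      = (real N - b0) / b0 * w + (m - \<mu>) + \<rho> / t"
    by (simp add: w_def)
  have "\<bar>real N - b0\<bar> / b0 \<le> (Y * t + \<bar>\<alpha>\<bar>) / D"
    using b0D D b j by (intro frac_le) auto
  then have "\<bar>(real N - b0) / b0 * w\<bar> \<le> (Y * t + \<bar>\<alpha>\<bar>) / D * (4 * Y + \<bar>\<mu>\<bar> + (3 * \<bar>\<alpha>\<bar> + 2) / t)"
    unfolding abs_mult using w b0 D b j by (intro mult_mono) (auto intro!: divide_nonneg_pos)
  moreover have "\<bar>\<rho> / t\<bar> \<le> (3 * \<bar>\<alpha>\<bar> + 2) / t" using \<rho> t0 by (simp add: divide_right_mono)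
  ultimately show "\<bar>t ^ 2 * (z - (2 * real (N - j) + \<alpha> - 1) - b0 - b1) / b0 - (4 * (real (Suc j) / t) - m)\<bar>
      \<le> (Y * t + \<bar>\<alpha>\<bar>) / D * (4 * Y + \<bar>\<mu>\<bar> + (3 * \<bar>\<alpha>\<bar> + 2) / t) + \<bar>\<mu> - m\<bar> + (3 * \<bar>\<alpha>\<bar> + 2) / t"
    unfolding eq by linarith
qed

section \<open>Uniform convergence of the scaled eigenvector\<close>

lemma C1_bound_on_interval:
  fixes G G' :: "real \<Rightarrow> real"
  assumes "\<And>y. (G has_real_derivative G' y) (at y)" "\<And>y. (G' has_real_derivative G'' y) (at y)"
  obtains M where "M \<ge> 0" "\<And>y. y \<in> {0..Y} \<Longrightarrow> \<bar>G y\<bar> \<le> M" "\<And>y. y \<in> {0..Y} \<Longrightarrow> \<bar>G' y\<bar> \<le> M"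
proof -
  have "continuous_on {0..Y} G" "continuous_on {0..Y} G'"
    using assms by (auto intro!: continuous_at_imp_continuous_on DERIV_isCont)
  then have "bounded (G ` {0..Y})" "bounded (G' ` {0..Y})"
    by (auto intro!: compact_imp_bounded compact_continuous_image)
  then obtain A B where "\<forall>y\<in>{0..Y}. \<bar>G y\<bar> \<le> A" "\<forall>y\<in>{0..Y}. \<bar>G' y\<bar> \<le> B"
    unfolding bounded_iff by auto
  then show thesis by (intro that[of "max 0 (max A B)"]) force+
qed

lemma mean_value_error:
  fixes G G' :: "real \<Rightarrow> real"
  assumes "\<And>y. (G has_real_derivative G' y) (at y)" "a < b"
    and "\<And>x. a < x \<Longrightarrow> x < b \<Longrightarrow> \<bar>G' x - D\<bar> \<le> (b - a) * K"
  shows "\<bar>G b - G a - (b - a) * D\<bar> \<le> (b - a) * ((b - a) * K)"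
proof -
  obtain x where x: "a < x" "x < b" "G b - G a = (b - a) * G' x"
    using MVT2[OF assms(2), of G G'] assms(1) by auto
  then have "\<bar>G b - G a - (b - a) * D\<bar> = (b - a) * \<bar>G' x - D\<bar>"
    using assms(2) by (simp add: abs_mult flip: right_diff_distrib)
  also have "\<dots> \<le> (b - a) * ((b - a) * K)"
    using assms(3)[OF x(1,2)] assms(2) by (intro mult_left_mono) auto
  finally show ?thesis .
qed

lemma lipschitz_on_interval:
  fixes G G' :: "real \<Rightarrow> real"
  assumes "\<And>y. (G has_real_derivative G' y) (at y)" "\<And>x. x \<in> {l..u} \<Longrightarrow> \<bar>G' x\<bar> \<le> K"
    and "a \<in> {l..u}" "b \<in> {l..u}"
  shows "\<bar>G a - G b\<bar> \<le> K * \<bar>a - b\<bar>"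
  using field_differentiable_bound[of "{l..u}" G G' K a b] assms
  by (auto intro: has_field_derivative_at_within)

text \<open>Stated for a filter below \<open>sequentially\<close>, so that it serves subsequences as
  well as the full sequence.\<close>

lemma top_vec_scaled_converges:
  fixes G G' :: "real \<Rightarrow> real"
  assumes \<alpha>: "\<alpha> > -1" and F: "F \<le> sequentially" and \<mu>: "(lag_defect \<alpha> \<longlongrightarrow> m) F" and Y: "Y > 0"
    and G: "\<And>y. (G has_real_derivative G' y) (at y)"
    and G': "\<And>y. (G' has_real_derivative (4 * y - m) * G y) (at y)"
    and ini: "G 0 = 0" "G' 0 = 2" and e: "e > 0"
  shows "eventually (\<lambda>N. \<forall>j. real j \<le> Y * real N powr (1/3) \<longrightarrow>
    \<bar>real N powr (1/6) * top_vec \<alpha> N j - G (real j / real N powr (1/3))\<bar> < e) F"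
proof -
  obtain M where M: "M \<ge> 0" "\<And>y. y \<in> {0..Y} \<Longrightarrow> \<bar>G y\<bar> \<le> M" "\<And>y. y \<in> {0..Y} \<Longrightarrow> \<bar>G' y\<bar> \<le> M"
    using C1_bound_on_interval[OF G G'] by blast
  define C where "C = 4 * Y + \<bar>m\<bar>"
  have C: "C \<ge> 0" using Y by (simp add: C_def)
  have Q: "\<bar>4 * y - m\<bar> \<le> C" if "y \<in> {0..Y}" for y using that by (auto simp: C_def)
  define t where "t = (\<lambda>N. real N powr (1/3))"
  define D where "D = (\<lambda>N. real N - Y * t N - \<bar>\<alpha>\<bar>)"
  define \<epsilon> where "\<epsilon> = (\<lambda>N. (Y * t N + \<bar>\<alpha>\<bar>) / D N * (4 * Y + \<bar>lag_defect \<alpha> N\<bar> + (3 * \<bar>\<alpha>\<bar> + 2) / t N)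
     + \<bar>lag_defect \<alpha> N - m\<bar> + (3 * \<bar>\<alpha>\<bar> + 2) / t N + t N * (1 + 2 * \<bar>\<alpha>\<bar>) / D N)"
  \<comment> \<open>G'' is bounded by C M and its derivative by 4 M + C M on [0, Y]; the second
    bound covers both truncation errors, each with one factor of the step 1 / t.\<close>
  define \<kappa> where "\<kappa> = (\<lambda>N. (4 * M + C * M) / t N)"
  \<comment> \<open>The error of the initial slope: \<open>d 0\<close> equals sqrt (z / (N +
    \<alpha>)), written through the defect so that its limit 2 is visible.\<close>
  define T where "T = (\<lambda>N. \<bar>sqrt (4 * (real N / (real N + \<alpha>)) - lag_defect \<alpha> N * (t N / (real N + \<alpha>))) - 2\<bar>)"
  define B where "B = (\<lambda>N. (T N + Y * ((C + 3) * \<kappa> N + 2 * \<epsilon> N * M)) * exp ((C + 3) * Y))"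
  note lim = tendsto_mono[OF F] filter_leD[OF F]
  have l1: "((\<lambda>N. (Y * t N + \<bar>\<alpha>\<bar>) / D N) \<longlongrightarrow> 0) F" unfolding t_def D_def using Y
    by (intro lim(1)) real_asymp
  have l2: "((\<lambda>N. (3 * \<bar>\<alpha>\<bar> + 2) / t N) \<longlongrightarrow> 0) F" unfolding t_def
    by (intro lim(1)) real_asymp
  have l3: "((\<lambda>N. t N * (1 + 2 * \<bar>\<alpha>\<bar>) / D N) \<longlongrightarrow> 0) F" unfolding t_def D_def
    by (intro lim(1)) real_asymp
  have l4: "((\<lambda>N. real N / (real N + \<alpha>)) \<longlongrightarrow> 1) F" "((\<lambda>N. t N / (real N + \<alpha>)) \<longlongrightarrow> 0) F"
    unfolding t_def by (intro lim(1); real_asymp)+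
  have "(\<epsilon> \<longlongrightarrow> 0 * (4 * Y + \<bar>m\<bar> + 0) + \<bar>m - m\<bar> + 0 + 0) F"
    unfolding \<epsilon>_def by (intro tendsto_intros l1 l2 l3 \<mu>)
  then have \<epsilon>_lim: "(\<epsilon> \<longlongrightarrow> 0) F" by simp
  have "(\<kappa> \<longlongrightarrow> 0) F" unfolding \<kappa>_def t_def by (intro lim(1)) real_asymp
  moreover have "(T \<longlongrightarrow> \<bar>sqrt (4 * 1 - m * 0) - 2\<bar>) F"
    unfolding T_def by (intro tendsto_intros l4 \<mu>)
  ultimately have "(B \<longlongrightarrow> (0 + Y * ((C + 3) * 0 + 2 * 0 * M)) * exp ((C + 3) * Y)) F"
    unfolding B_def by (intro tendsto_intros \<epsilon>_lim) simp_all
  then have "eventually (\<lambda>N. B N < e) F" using e by (intro order_tendstoD(2)) auto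
  moreover have "eventually (\<lambda>N. \<epsilon> N < 1) F" by (rule order_tendstoD(2)[OF \<epsilon>_lim]) simp
  moreover have "eventually (\<lambda>N. t N \<ge> 1) F" "eventually (\<lambda>N. D N > 0) F" "eventually (\<lambda>N. N > 0) F"
    unfolding t_def D_def using Y by (intro lim(2); real_asymp)+
  ultimately show ?thesis
  proof eventually_elim
    case (elim N)
    let ?z = "largest_laguerre_zero \<alpha> N"
    note N = \<open>0 < N\<close>
    define h where "h = 1 / t N"
    define X where "X = (\<lambda>j. real N powr (1/6) * top_vec \<alpha> N j)"
    define d where "d = (\<lambda>j. t N * (X (Suc j) - X j))"
    define b0 b1 where "b0 = (\<lambda>j. jac_b \<alpha> (N - Suc j))" and "b1 = (\<lambda>j. jac_b \<alpha> (N - j))"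
    define q where "q = (\<lambda>j. t N ^ 2 * (?z - (2 * real (N - j) + \<alpha> - 1) - b0 j - b1 j) / b0 j)"
    define s where "s = (\<lambda>j. t N * (b1 j - b0 j) / b0 j)"
    define J where "J = nat \<lfloor>Y * t N\<rfloor>"
    have t3: "t N ^ 3 = real N"
      using N by (simp add: t_def powr_realpow[symmetric] powr_powr)
    have h: "0 < h" "h \<le> 1" using elim by (auto simp: h_def)
    have zt: "?z = 4 * real N - lag_defect \<alpha> N * t N" using elim by (simp add: t_def)
    have YJ: "real (Suc j) \<le> Y * t N" if "j < J" for j
      using that elim Y unfolding J_def by linarith
    have est: "b0 j > 0" "\<bar>q j - (4 * (real (Suc j) * h) - m)\<bar> \<le> \<epsilon> N" "\<bar>s j\<bar> \<le> \<epsilon> N" if "j < J" for j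
    proof -
      have p: "(Y * t N + \<bar>\<alpha>\<bar>) / D N * (4 * Y + \<bar>lag_defect \<alpha> N\<bar> + (3 * \<bar>\<alpha>\<bar> + 2) / t N) \<ge> 0"
        "(3 * \<bar>\<alpha>\<bar> + 2) / t N \<ge> 0" "t N * (1 + 2 * \<bar>\<alpha>\<bar>) / D N \<ge> 0"
        using elim Y by auto
      note E = scaled_coefficient_estimates[OF \<alpha> N YJ[OF that] \<open>1 \<le> t N\<close> t3 _ \<open>0 < D N\<close> zt]
      show "b0 j > 0" unfolding b0_def by (rule E(1)) (simp add: D_def)
      have "\<bar>q j - (4 * (real (Suc j) / t N) - m)\<bar>
        \<le> (Y * t N + \<bar>\<alpha>\<bar>) / D N * (4 * Y + \<bar>lag_defect \<alpha> N\<bar> + (3 * \<bar>\<alpha>\<bar> + 2) / t N)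
          + \<bar>lag_defect \<alpha> N - m\<bar> + (3 * \<bar>\<alpha>\<bar> + 2) / t N"
        unfolding q_def b0_def b1_def by (rule E(2)) (simp add: D_def)
      also have "\<dots> \<le> \<epsilon> N" using p(3) by (simp add: \<epsilon>_def)
      finally show "\<bar>q j - (4 * (real (Suc j) * h) - m)\<bar> \<le> \<epsilon> N" by (simp add: h_def)
      have "\<bar>s j\<bar> \<le> t N * (1 + 2 * \<bar>\<alpha>\<bar>) / D N"
        unfolding s_def b0_def b1_def by (rule E(3)) (simp add: D_def)
      then show "\<bar>s j\<bar> \<le> \<epsilon> N" using p unfolding \<epsilon>_def by linarith
    qed
    have jh: "real j * h \<in> {0..Y}" if "j \<le> J" for j
    proof -
      have "Y * t N \<ge> 0" using Y elim by simp
      then have "real j \<le> Y * t N" using that unfolding J_def by linarith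
      then show ?thesis using elim by (simp add: h_def divide_le_eq)
    qed
    have diff: "real (Suc j) * h - real j * h = h" for j by (simp add: algebra_simps)
    have \<epsilon>0: "0 \<le> \<epsilon> N"
      using elim Y unfolding \<epsilon>_def by (intro add_nonneg_nonneg mult_nonneg_nonneg divide_nonneg_pos) auto
    have G2: "\<bar>(4 * x - m) * G x\<bar> \<le> C * M" if "x \<in> {0..Y}" for x
      unfolding abs_mult using Q[OF that] M(2)[OF that] C by (intro mult_mono) auto
    have G3: "\<bar>4 * G x + (4 * x - m) * G' x\<bar> \<le> 4 * M + C * M" if "x \<in> {0..Y}" for x
    proof -
      have "\<bar>(4 * x - m) * G' x\<bar> \<le> C * M"
        unfolding abs_mult using Q[OF that] M(3)[OF that] C by (intro mult_mono) auto
      then show ?thesis using M(2)[OF that] by linarith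
    qed
    have G2': "((\<lambda>y. (4 * y - m) * G y) has_real_derivative 4 * G x + (4 * x - m) * G' x) (at x)" for x
      by (auto intro!: derivative_eq_intros G)
    have err: "\<bar>X j - G (real j * h)\<bar> + \<bar>d j - G' (real j * h)\<bar> \<le>
      (\<bar>X 0 - G 0\<bar> + \<bar>d 0 - G' 0\<bar> + real j * h * ((C + 3) * \<kappa> N + 2 * \<epsilon> N * M)) * exp ((C + 3) * h) ^ j"
      if "j \<le> J" for j
    proof (rule euler_error[where Q = "\<lambda>y. 4 * y - m" and J = J and q = q and s = s])
      show "X (Suc j) = X j + h * d j" for j using elim by (simp add: d_def h_def)
      show "d (Suc j) = d j + h * (q j * X (Suc j) + s j * d j)" if "j < J" for j
      proof -
        note b = est(1)[OF that]
        \<comment> \<open>For j \<ge> N the truncated subtraction would make b0 j equal to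
          \<open>jac_b \<alpha> 0 = 0\<close>.\<close>
        have jN: "j < N" by (rule ccontr) (use b in \<open>simp add: b0_def\<close>)
        define v where "v = (\<lambda>j. top_vec \<alpha> N j)"
        have rec: "?z * v (Suc j) = b1 j * v j + (2 * real (N - j) + \<alpha> - 1) * v (Suc j) + b0 j * v (Suc (Suc j))"
          unfolding v_def b0_def b1_def by (rule top_vec_rec[OF \<alpha> N jN])
        \<comment> \<open>The eigenvalue equation around a centred second difference; the asymmetry
          b1 - b0 multiplies the first difference and becomes s.\<close>
        have "b0 j * (v (Suc (Suc j)) - 2 * v (Suc j) + v j) =
            (?z - (2 * real (N - j) + \<alpha> - 1) - b0 j - b1 j) * v (Suc j) + (b1 j - b0 j) * (v (Suc j) - v j)"
          using rec by (simp add: algebra_simps)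
        note A = this
        have "b0 j \<noteq> 0" using b by simp
        then have vv: "v (Suc (Suc j)) - 2 * v (Suc j) + v j =
            (?z - (2 * real (N - j) + \<alpha> - 1) - b0 j - b1 j) / b0 j * v (Suc j)
              + (b1 j - b0 j) / b0 j * (v (Suc j) - v j)"
          using arg_cong[OF A, of "\<lambda>x. x / b0 j"]
          by (simp only: nonzero_mult_div_cancel_left[OF \<open>b0 j \<noteq> 0\<close>] add_divide_distrib times_divide_eq_left)
        define p where "p = real N powr (1/6)"
        have X: "X i = p * v i" for i by (simp add: X_def v_def p_def)
        have "d (Suc j) - d j = t N * p * (v (Suc (Suc j)) - 2 * v (Suc j) + v j)"
          by (simp add: d_def X algebra_simps)
        also have "\<dots> = h * (q j * X (Suc j) + s j * d j)"
          unfolding vv q_def s_def X d_def h_def using \<open>1 \<le> t N\<close> b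
          by (simp add: divide_simps power2_eq_square) (simp add: algebra_simps)
        finally show ?thesis by simp
      qed
      show "\<bar>G (real (Suc j) * h) - G (real j * h) - h * G' (real j * h)\<bar> \<le> h * \<kappa> N" if "j < J" for j
      proof -
        have in_int: "x \<in> {0..Y}" if "real j * h \<le> x" "x \<le> real (Suc j) * h" for x
          using that jh[of j] jh[of "Suc j"] \<open>j < J\<close> by auto
        have "\<bar>G (real (Suc j) * h) - G (real j * h) - (real (Suc j) * h - real j * h) * G' (real j * h)\<bar>
            \<le> (real (Suc j) * h - real j * h) * ((real (Suc j) * h - real j * h) * (4 * M + C * M))"
        proof (rule mean_value_error[OF G])
          show "real j * h < real (Suc j) * h" using h diff[of j] by linarith
          fix x assume x: "real j * h < x" "x < real (Suc j) * h"
          have "\<bar>G' x - G' (real j * h)\<bar> \<le> C * M * \<bar>x - real j * h\<bar>"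
            by (rule lipschitz_on_interval[OF G' G2]) (use x h in \<open>auto simp del: atLeastAtMost_iff of_nat_Suc intro: in_int less_imp_le\<close>)
          also have "\<dots> \<le> (4 * M + C * M) * (real (Suc j) * h - real j * h)"
            using x C M by (intro mult_mono) auto
          finally show "\<bar>G' x - G' (real j * h)\<bar> \<le> (real (Suc j) * h - real j * h) * (4 * M + C * M)"
            by (simp only: mult.commute)
        qed
        then show ?thesis unfolding diff by (simp add: \<kappa>_def h_def)
      qed
      show "\<bar>G' (real (Suc j) * h) - G' (real j * h)
          - h * ((4 * (real (Suc j) * h) - m) * G (real (Suc j) * h))\<bar> \<le> h * \<kappa> N" if "j < J" for j
      proof -
        have in_int: "x \<in> {0..Y}" if "real j * h \<le> x" "x \<le> real (Suc j) * h" for x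
          using that jh[of j] jh[of "Suc j"] \<open>j < J\<close> by auto
        let ?y = "real (Suc j) * h"
        have "\<bar>G' ?y - G' (real j * h) - (?y - real j * h) * ((4 * ?y - m) * G ?y)\<bar>
            \<le> (?y - real j * h) * ((?y - real j * h) * (4 * M + C * M))"
        proof (rule mean_value_error[OF G'])
          show "real j * h < ?y" using h diff[of j] by linarith
          fix x assume x: "real j * h < x" "x < ?y"
          have "\<bar>(4 * x - m) * G x - (4 * ?y - m) * G ?y\<bar> \<le> (4 * M + C * M) * \<bar>x - ?y\<bar>"
            by (rule lipschitz_on_interval[OF G2' G3]) (use x h in \<open>auto simp del: atLeastAtMost_iff of_nat_Suc intro: in_int less_imp_le\<close>)
          also have "\<dots> \<le> (4 * M + C * M) * (?y - real j * h)"
            using x C M by (intro mult_left_mono) auto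
          finally show "\<bar>(4 * x - m) * G x - (4 * ?y - m) * G ?y\<bar> \<le> (?y - real j * h) * (4 * M + C * M)"
            by (simp only: mult.commute)
        qed
        then show ?thesis unfolding diff by (simp add: \<kappa>_def h_def)
      qed
      show "0 \<le> \<kappa> N" using M C elim by (simp add: \<kappa>_def)
      show "\<epsilon> N \<le> 1" using elim by simp
      show "\<bar>4 * (real (Suc j) * h) - m\<bar> \<le> C" "\<bar>G (real (Suc j) * h)\<bar> \<le> M" "\<bar>G' (real j * h)\<bar> \<le> M"
        if "j < J" for j
        using that by (intro Q M jh; simp)+
      show "\<bar>q j - (4 * (real (Suc j) * h) - m)\<bar> \<le> \<epsilon> N" "\<bar>s j\<bar> \<le> \<epsilon> N" if "j < J" for j
        using est(2,3)[OF that] by blast+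
    qed (rule h M(1) C \<epsilon>0 that)+
    have X0: "X 0 = 0" by (simp add: X_def top_vec_0[OF \<alpha> N])
    have d0: "\<bar>d 0 - G' 0\<bar> = T N"
    proof -
      have Npos: "real N + \<alpha> > 0" using N \<alpha> by linarith
      have "d 0 = t N * (real N powr (1/6) * (sqrt ?z / jac_b \<alpha> N))"
        using top_vec_1[OF \<alpha> N] by (simp add: d_def X0) (simp add: X_def)
      also have "\<dots> = sqrt ((t N)\<^sup>2 * real N powr (1/3) * (?z / (real N * (real N + \<alpha>))))"
      proof -
        have "sqrt ((t N)\<^sup>2) = t N" using elim by simp
        moreover have "sqrt (real N powr (1/3)) = real N powr (1/6)"
          using N by (simp add: powr_half_sqrt[symmetric] powr_powr)
        ultimately show ?thesis
          by (simp add: real_sqrt_mult real_sqrt_divide jac_b_def)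
      qed
      also have "(t N)\<^sup>2 * real N powr (1/3) * (?z / (real N * (real N + \<alpha>))) = ?z / (real N + \<alpha>)"
      proof -
        have "(t N)\<^sup>2 * real N powr (1/3) = real N"
          using t3 by (simp add: t_def power2_eq_square power3_eq_cube)
        then show ?thesis using N by simp
      qed
      also have "?z / (real N + \<alpha>) = 4 * (real N / (real N + \<alpha>)) - lag_defect \<alpha> N * (t N / (real N + \<alpha>))"
        by (subst zt) (simp add: diff_divide_distrib)
      finally show ?thesis by (simp add: T_def ini)
    qed
    show ?case
    proof (intro allI impI)
      fix j assume "real j \<le> Y * real N powr (1/3)"
      then have j: "j \<le> J" unfolding J_def t_def by linarith
      have "\<bar>X j - G (real j * h)\<bar> \<le>
        (T N + real j * h * ((C + 3) * \<kappa> N + 2 * \<epsilon> N * M)) * exp ((C + 3) * h) ^ j"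
        using err[OF j] by (simp add: X0 ini(1) d0)
      also have "\<dots> \<le> B N"
        unfolding B_def
      proof (intro mult_mono add_mono order_refl)
        have "exp ((C + 3) * h) ^ j = exp ((C + 3) * (real j * h))"
          by (simp add: exp_of_nat_mult[symmetric] mult_ac)
        also have "\<dots> \<le> exp ((C + 3) * Y)"
          using jh[OF j] C by (auto intro!: mult_left_mono)
        finally show "exp ((C + 3) * h) ^ j \<le> exp ((C + 3) * Y)" .
      qed (use jh[OF j] Y C M \<epsilon>0 elim in \<open>auto simp: T_def \<kappa>_def\<close>)
      also have "\<dots> < e" using elim by simp
      finally show "\<bar>real N powr (1/6) * top_vec \<alpha> N j - G (real j / real N powr (1/3))\<bar> < e"
        by (simp add: X_def h_def t_def)
    qed
  qed
qed

text \<open>The \<open>Suc\<close> is the index shift of \<open>top_vec\<close>, whose component k +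
  1 carries Q_k.\<close>

definition scaled_top_vec :: "real \<Rightarrow> nat \<Rightarrow> real \<Rightarrow> real" where
  "scaled_top_vec \<alpha> N y = real N powr (1/6) * top_vec \<alpha> N (Suc (nat \<lfloor>real N powr (1/3) * y\<rfloor>))"

lemma scaled_top_vec_converges:
  fixes G G' :: "real \<Rightarrow> real"
  assumes \<alpha>: "\<alpha> > -1" and F: "F \<le> sequentially" and \<mu>: "(lag_defect \<alpha> \<longlongrightarrow> m) F" and Y: "Y > 0"
    and G: "\<And>y. (G has_real_derivative G' y) (at y)"
    and G': "\<And>y. (G' has_real_derivative (4 * y - m) * G y) (at y)"
    and ini: "G 0 = 0" "G' 0 = 2"
  shows "uniform_limit {0..Y} (scaled_top_vec \<alpha>) G F"
proof (rule uniform_limitI)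
  fix e :: real assume e: "e > 0"
  \<comment> \<open>The grid point used for y lies up to 1 / t \<le> 1 to its right, so bounds on
    [0, Y+1] are needed.\<close>
  obtain M where M: "M \<ge> 0" "\<And>y. y \<in> {0..Y+1} \<Longrightarrow> \<bar>G y\<bar> \<le> M" "\<And>y. y \<in> {0..Y+1} \<Longrightarrow> \<bar>G' y\<bar> \<le> M"
    using C1_bound_on_interval[OF G G'] by blast
  have "((\<lambda>N. M / real N powr (1/3)) \<longlongrightarrow> 0) F"
    by (rule tendsto_mono[OF F]) real_asymp
  then have "eventually (\<lambda>N. M / real N powr (1/3) < e / 2) F"
    using e by (intro order_tendstoD(2)) auto
  moreover have "eventually (\<lambda>N. real N powr (1/3) \<ge> 1) F"
    by (rule filter_leD[OF F]) real_asymp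
  moreover have "eventually (\<lambda>N. \<forall>j. real j \<le> (Y + 1) * real N powr (1/3) \<longrightarrow>
      \<bar>real N powr (1/6) * top_vec \<alpha> N j - G (real j / real N powr (1/3))\<bar> < e / 2) F"
    by (rule top_vec_scaled_converges[OF \<alpha> F \<mu> _ G G' ini]) (use Y e in auto)
  ultimately show "eventually (\<lambda>N. \<forall>y\<in>{0..Y}. dist (scaled_top_vec \<alpha> N y) (G y) < e) F"
  proof eventually_elim
    case (elim N)
    define t where "t = real N powr (1/3)"
    have t: "t \<ge> 1" using elim by (simp add: t_def)
    show ?case
    proof
      fix y assume y: "y \<in> {0..Y}"
      define j where "j = Suc (nat \<lfloor>t * y\<rfloor>)"
      have "t * y \<ge> 0" using t y by simp
      then have j: "t * y \<le> real j" "real j \<le> t * y + 1" unfolding j_def by linarith+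
      have "t * y \<le> t * Y" using t y by simp
      moreover have "(Y + 1) * t = t * Y + t" by (simp add: algebra_simps)
      ultimately have jY: "real j \<le> (Y + 1) * t" using j t by linarith
      have jt: "y \<le> real j / t" "real j / t \<le> y + 1 / t" "real j / t \<le> Y + 1"
        using j jY t by (simp_all add: field_simps)
      have "\<bar>G (real j / t) - G y\<bar> \<le> M * \<bar>real j / t - y\<bar>"
        using y jt by (intro lipschitz_on_interval[OF G, where l = 0 and u = "Y + 1"] M(3)) auto
      also have "\<dots> \<le> M * (1 / t)" using jt M by (intro mult_left_mono) auto
      also have "\<dots> < e / 2" using elim by (simp add: t_def)
      finally have "\<bar>G (real j / t) - G y\<bar> < e / 2" .
      moreover have "\<bar>scaled_top_vec \<alpha> N y - G (real j / t)\<bar> < e / 2"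
        unfolding scaled_top_vec_def t_def j_def
        by (rule elim(3)[rule_format, OF jY[unfolded t_def j_def]])
      ultimately show "dist (scaled_top_vec \<alpha> N y) (G y) < e"
        unfolding dist_real_def by linarith
    qed
  qed
qed

lemma eventually_cube_root_less:
  "eventually (\<lambda>N. real N powr (1/3) * y + 1 < real N) sequentially"
proof -
  have "(\<lambda>N. (real N powr (1/3) * y + 1) / real N) \<longlonglongrightarrow> 0" by real_asymp
  then have "eventually (\<lambda>N. (real N powr (1/3) * y + 1) / real N < 1) sequentially"
    by (intro order_tendstoD(2)) auto
  then show ?thesis using eventually_gt_at_top[of 0]
    by eventually_elim (simp add: divide_less_eq)
qed

text \<open>Change of variables \<open>t = 2\<^bsup>2/3\<^esup> y - m / 2\<^bsup>4/3\<^esup>\<close> between the limit equation and the Airy equation.\<close>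

lemma limit_is_airy:
  assumes \<alpha>: "\<alpha> > -1" and F: "F \<le> sequentially" "F \<noteq> bot" and \<mu>: "(lag_defect \<alpha> \<longlongrightarrow> m) F"
  shows "m = - 2 * 2 powr (1/3) * airy_a1"
    and "Y > 0 \<Longrightarrow> uniform_limit {0..Y} (scaled_top_vec \<alpha>)
      (\<lambda>y. 2 powr (1/3) * airy_Ai (2 powr (2/3) * y + airy_a1) / deriv airy_Ai airy_a1) F"
proof -
  define c :: real where "c = 2 powr (1/3)"
  have c: "c > 0" "c * c * c = 2" "2 powr (2/3) = c * c"
    by (simp_all add: c_def powr_add[symmetric])
  define s where "s = - m / (2 * c)"
  \<comment> \<open>Slope c at s makes the slope of G at 0 equal to c * c * c = 2.\<close>
  obtain H H' where H: "airy_sol H H'" "H s = 0" "H' s = c"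
    using airy_sol_exists_at by blast
  define G where "G = (\<lambda>y. H (c * c * y + s))"
  define G' where "G' = (\<lambda>y. c * c * H' (c * c * y + s))"
  have G: "(G has_real_derivative G' y) (at y)" for y
    unfolding G_def G'_def
    by (rule DERIV_chain'[where f = "\<lambda>y. c * c * y + s", THEN DERIV_cong, OF _ airy_solD(1)[OF H(1)]])
      (auto intro!: derivative_eq_intros)
  have "c * c * (c * c) * (c * c * y + s) = 4 * y - m" for y
  proof -
    have "c * c * (c * c) * (c * c * y + s) = (c * c * c) * (c * c * c) * y + (c * c * c) * (c * s)"
      by (simp add: algebra_simps)
    moreover have "c * s = - m / 2" using c(1) by (simp add: s_def)
    ultimately show ?thesis unfolding c(2) by simp
  qed
  note cc = this
  have G': "(G' has_real_derivative (4 * y - m) * G y) (at y)" for y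
  proof -
    have "(G' has_real_derivative c * c * (((c * c * y + s) * H (c * c * y + s)) * (c * c))) (at y)"
      unfolding G'_def
      by (intro DERIV_cmult DERIV_chain2[where f = H' and g = "\<lambda>y. c * c * y + s"] airy_solD(2)[OF H(1)])
        (auto intro!: derivative_eq_intros)
    also have "c * c * (((c * c * y + s) * H (c * c * y + s)) * (c * c)) = (4 * y - m) * G y"
      unfolding cc[symmetric] G_def by (simp add: mult_ac)
    finally show ?thesis .
  qed
  have ini: "G 0 = 0" "G' 0 = 2" using H c by (simp_all add: G_def G'_def)
  have conv: "uniform_limit {0..Y} (scaled_top_vec \<alpha>) G F" if "Y > 0" for Y
    by (rule scaled_top_vec_converges[OF \<alpha> F(1) \<mu> that G G' ini])
  have pw: "((\<lambda>N. scaled_top_vec \<alpha> N y) \<longlongrightarrow> G y) F" if "y \<ge> 0" for y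
    by (rule tendsto_uniform_limitI[OF conv[of "y + 1"]]) (use that in auto)
  note lim = filter_leD[OF F(1)]
  have ev: "eventually (\<lambda>N. N > 0) F" by (rule lim) (rule eventually_gt_at_top)
  have idx: "eventually (\<lambda>N. Suc (nat \<lfloor>real N powr (1/3) * y\<rfloor>) < N) F" if "y \<ge> 0" for y
  proof -
    have "eventually (\<lambda>N. real N powr (1/3) * y + 1 < real N) F"
      by (rule lim[OF eventually_cube_root_less])
    then show ?thesis
    proof eventually_elim
      case (elim N)
      have "real N powr (1/3) * y \<ge> 0" using that by simp
      with elim show ?case by linarith
    qed
  qed
  have G_nonneg: "G y \<ge> 0" if "y \<ge> 0" for y
  proof (rule tendsto_lowerbound[OF pw[OF that] _ F(2)])
    show "eventually (\<lambda>N. 0 \<le> scaled_top_vec \<alpha> N y) F"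
      using idx[OF that] ev
    proof eventually_elim
      case (elim N)
      then have "top_vec \<alpha> N (Suc (nat \<lfloor>real N powr (1/3) * y\<rfloor>)) > 0"
        by (intro top_vec_pos[OF \<alpha>]) auto
      then show ?case by (simp add: scaled_top_vec_def)
    qed
  qed
  \<comment> \<open>For u \<ge> y0, 4 t u \<ge> (|m| + 4) t. Of this (|m| + 1) t exceeds the defect
    and the remaining 3 t exceeds 2 |\<alpha>|, as \<open>top_vec_decreasing\<close>
    requires.\<close>
  define y0 where "y0 = \<bar>m\<bar> / 4 + 1"
  have G_anti: "G v \<le> G u" if uv: "y0 \<le> u" "u \<le> v" for u v
  proof (rule tendsto_le[OF F(2) pw pw])
    show "u \<ge> 0" "v \<ge> 0" using uv by (auto simp: y0_def)
    have "eventually (\<lambda>N. lag_defect \<alpha> N < \<bar>m\<bar> + 1) F"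
      by (rule order_tendstoD(2)[OF \<mu>]) simp
    moreover have "eventually (\<lambda>N. 2 * \<bar>\<alpha>\<bar> < 3 * real N powr (1/3)) F"
      by (intro lim) real_asymp
    ultimately show "eventually (\<lambda>N. scaled_top_vec \<alpha> N v \<le> scaled_top_vec \<alpha> N u) F"
      using idx[OF \<open>v \<ge> 0\<close>] ev
    proof eventually_elim
      case (elim N)
      define t where "t = real N powr (1/3)"
      have t: "t > 0" using elim by (simp add: t_def)
      define i j where "i = Suc (nat \<lfloor>t * u\<rfloor>)" and "j = Suc (nat \<lfloor>t * v\<rfloor>)"
      have "t * u \<le> t * v" using uv t by simp
      then have ij: "i \<le> j" unfolding i_def j_def by (intro Suc_leI le_imp_less_Suc nat_mono floor_mono)
      have jN: "j < N" using elim by (simp add: j_def t_def)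
      have ti: "t * u \<le> real i" unfolding i_def by linarith
      have z: "largest_laguerre_zero \<alpha> N > 4 * real N - (\<bar>m\<bar> + 1) * t"
        using elim(1) t by (simp add: t_def[symmetric] divide_less_eq)
      have "(\<bar>m\<bar> + 4) * t \<le> 4 * (t * u)"
        using mult_left_mono[OF uv(1), of "4 * t"] t by (simp add: y0_def algebra_simps)
      then have small: "4 * real i > (\<bar>m\<bar> + 1) * t + 2 * \<bar>\<alpha>\<bar>"
        using elim(2) ti unfolding t_def[symmetric] by (simp add: algebra_simps)
      have "top_vec \<alpha> N j \<le> top_vec \<alpha> N i"
        using ij jN
      proof (induction j rule: dec_induct)
        case (step k)
        have "top_vec \<alpha> N (Suc k) < top_vec \<alpha> N k"
          using step z small by (intro top_vec_decreasing[OF \<alpha>]) (auto simp: of_nat_diff)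
        then show ?case using step by simp
      qed simp
      then show ?case
        unfolding scaled_top_vec_def t_def[symmetric] i_def[symmetric] j_def[symmetric]
        by (intro mult_left_mono) auto
    qed
  qed
  have HG: "H t = G ((t - s) / (c * c))" for t
    using c(1) by (simp add: G_def)
  have cc0: "c * c > 0" using c(1) by simp
  have nonneg: "H t \<ge> 0" if "t \<ge> s" for t
    unfolding HG using that cc0 by (intro G_nonneg) auto
  have anti: "H v \<le> H u" if "s + c * c * y0 \<le> u" "u \<le> v" for u v
    unfolding HG
  proof (rule G_anti)
    show "y0 \<le> (u - s) / (c * c)" using that cc0 by (simp add: pos_le_divide_eq algebra_simps)
    show "(u - s) / (c * c) \<le> (v - s) / (c * c)" using that cc0 by (intro divide_right_mono) auto
  qed
  have nz: "H' s \<noteq> 0" using H c by simp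
  \<comment> \<open>This yields \<open>airy_a1 = s\<close>. As s was defined from m, every
    subsequential limit of the defect is thereby determined.\<close>
  note ground = airy_ground_state[OF H(1,2) nz nonneg anti]
  have a1: "airy_a1 = s" by (rule ground(1))
  show "m = - 2 * 2 powr (1/3) * airy_a1"
    unfolding a1 s_def c_def[symmetric] using c(1) by simp
  have "c * airy_Ai (c * c * y + airy_a1) / deriv airy_Ai airy_a1 = G y" for y
  proof -
    have "c * (airy_Ai (c * c * y + s) / deriv airy_Ai airy_a1) = c * (H (c * c * y + s) / H' s)"
      using ground(2) by (rule arg_cong)
    then show ?thesis using H(3) c(1) by (simp add: a1 G_def)
  qed
  then show "uniform_limit {0..Y} (scaled_top_vec \<alpha>)
      (\<lambda>y. 2 powr (1/3) * airy_Ai (2 powr (2/3) * y + airy_a1) / deriv airy_Ai airy_a1) F" if "Y > 0"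
    unfolding c(3) c_def[symmetric] using conv[OF that] by presburger
qed

section \<open>From subsequences to the full sequence\<close>

lemma tendsto_of_unique_subsequential_limit:
  fixes x :: "nat \<Rightarrow> 'a :: heine_borel"
  assumes "bounded (range x)"
    and "\<And>r l. strict_mono r \<Longrightarrow> (x \<circ> r) \<longlonglongrightarrow> l \<Longrightarrow> l = a"
  shows "x \<longlonglongrightarrow> a"
proof (rule ccontr)
  assume "\<not> x \<longlonglongrightarrow> a"
  then obtain e where e: "e > 0" "\<not> eventually (\<lambda>n. dist (x n) a < e) sequentially"
    unfolding tendsto_iff by auto
  from e(2) have "infinite {n. \<not> dist (x n) a < e}"
    unfolding cofinite_eq_sequentially[symmetric] eventually_cofinite .
  from infinite_enumerate[OF this] obtain r :: "nat \<Rightarrow> nat"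
    where r: "strict_mono r" "\<forall>n. r n \<in> {n. \<not> dist (x n) a < e}" by (elim exE conjE)
  have "bounded (range (x \<circ> r))" by (rule bounded_subset[OF assms(1)]) auto
  from bounded_imp_convergent_subsequence[OF this] obtain l r'
    where r': "strict_mono r'" "(x \<circ> r \<circ> r') \<longlonglongrightarrow> l" by (elim exE conjE)
  have "l = a"
    by (rule assms(2)[OF strict_mono_o[OF r(1) r'(1)]]) (use r'(2) in \<open>simp only: o_assoc\<close>)
  have "eventually (\<lambda>n. dist ((x \<circ> r \<circ> r') n) a < e) sequentially"
    using tendstoD[OF r'(2) e(1)] unfolding \<open>l = a\<close> .
  from eventually_happens[OF this] show False using r(2) by auto
qed

text \<open>The upper and lower bounds for the largest zero give compactness, and
  \<open>limit_is_airy(1)\<close> leaves one possible limit. A subsequence r enters as the filter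
  \<open>filtermap r sequentially\<close>.\<close>

lemma lag_defect_tendsto:
  assumes \<alpha>: "\<alpha> > -1"
  shows "lag_defect \<alpha> \<longlonglongrightarrow> - 2 * 2 powr (1/3) * airy_a1"
proof (rule tendsto_of_unique_subsequential_limit)
  have "eventually (\<lambda>N. real N powr (1/3) \<ge> 1) sequentially" by real_asymp
  then have "eventually (\<lambda>N. norm (lag_defect \<alpha> N) \<le> 32 + 3 * \<bar>\<alpha>\<bar>) sequentially"
    using largest_laguerre_zero_lower[OF \<alpha>] eventually_gt_at_top[of 0]
  proof eventually_elim
    case (elim N)
    define t where "t = real N powr (1/3)"
    have t: "t \<ge> 1" using elim by (simp add: t_def)
    define K where "K = 32 + 3 * \<bar>\<alpha>\<bar>"
    have "K * t \<ge> K * 1" using t by (intro mult_left_mono) (auto simp: K_def)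
    moreover have "2 * \<bar>\<alpha>\<bar> \<le> K" by (simp add: K_def)
    ultimately have "\<bar>4 * real N - largest_laguerre_zero \<alpha> N\<bar> \<le> K * t"
      using largest_laguerre_zero_upper[OF \<alpha> elim(3)] elim(2)
      unfolding t_def[symmetric] K_def[symmetric] by (intro abs_leI) linarith+
    then show ?case using t unfolding t_def[symmetric] K_def[symmetric] by (simp add: divide_le_eq)
  qed
  then have "Bfun (lag_defect \<alpha>) sequentially" by (rule BfunI)
  then show "bounded (range (lag_defect \<alpha>))"
    by (simp add: Bseq_eq_bounded)
next
  fix r l assume r: "strict_mono r" "(lag_defect \<alpha> \<circ> r) \<longlonglongrightarrow> l"
  show "l = - 2 * 2 powr (1/3) * airy_a1"
  proof (rule limit_is_airy(1)[OF \<alpha>, of "filtermap r sequentially"])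
    show "filtermap r sequentially \<le> sequentially"
      using filterlim_subseq[OF r(1)] by (simp add: filterlim_def)
    show "(lag_defect \<alpha> \<longlongrightarrow> l) (filtermap r sequentially)"
      using r(2) by (simp add: filterlim_filtermap o_def)
  qed (simp add: filtermap_bot_iff)
qed

theorem theorem6p1:
  fixes \<alpha> :: real and f :: "nat \<Rightarrow> real \<Rightarrow> real"
  assumes "\<alpha> > -1"
    and f: "\<And>N y. N \<ge> 1 \<Longrightarrow> f N y =
      (if 0 \<le> y \<and> y < real N powr (2/3)
       then real N powr (1/6) * sqrt (largest_laguerre_zero \<alpha> N) *
            poly (dual_laguerre \<alpha> N (nat \<lfloor>real N powr (1/3) * y\<rfloor>)) (largest_laguerre_zero \<alpha> N)
       else 0)"
  shows "\<forall>K. compact K \<and> K \<subseteq> {0..} \<longrightarrow>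
    uniform_limit K f
      (\<lambda>y. 2 powr (1/3) * airy_Ai (2 powr (2/3) * y + airy_a1) / deriv airy_Ai airy_a1)
      sequentially"
proof (intro allI impI)
  fix K :: "real set" assume K: "compact K \<and> K \<subseteq> {0..}"
  obtain Y where Y: "Y > 0" "K \<subseteq> {0..Y}"
  proof -
    obtain B where "\<forall>x\<in>K. norm x \<le> B"
      using K compact_imp_bounded bounded_iff by blast
    then show thesis using K by (intro that[of "max 1 B"]) force+
  qed
  let ?g = "\<lambda>y. 2 powr (1/3) * airy_Ai (2 powr (2/3) * y + airy_a1) / deriv airy_Ai airy_a1"
  \<comment> \<open>Once N^(2/3) > Y the interval lies in the support of f N, and once N^(1/3) Y + 1
    < N all indices are below N, where \<open>dual_laguerre\<close> is determined.\<close>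
  have ev: "eventually (\<lambda>N. \<forall>y\<in>{0..Y}. f N y = scaled_top_vec \<alpha> N y) sequentially"
  proof -
    have "eventually (\<lambda>N. Y < real N powr (2/3)) sequentially" by real_asymp
    then show ?thesis using eventually_cube_root_less[of Y] eventually_gt_at_top[of 0]
    proof eventually_elim
      case (elim N)
      show ?case
      proof
        fix y assume y: "y \<in> {0..Y}"
        have "real N powr (1/3) * y \<ge> 0" "real N powr (1/3) * y \<le> real N powr (1/3) * Y"
          using y by (auto intro: mult_left_mono)
        then have "nat \<lfloor>real N powr (1/3) * y\<rfloor> < N" using elim by linarith
        from top_vec_dual_laguerre[OF assms(1) \<open>0 < N\<close> this]
        show "f N y = scaled_top_vec \<alpha> N y"
          using f[of N y] elim y by (simp add: scaled_top_vec_def)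
      qed
    qed
  qed
  have "uniform_limit {0..Y} (scaled_top_vec \<alpha>) ?g sequentially"
    by (rule limit_is_airy(2)[OF assms(1) order_refl _ lag_defect_tendsto[OF assms(1)] Y(1)]) simp
  then have "uniform_limit {0..Y} f ?g sequentially"
    using uniform_limit_cong[OF ev, of ?g ?g] by simp
  then show "uniform_limit K f ?g sequentially"
    by (rule uniform_limit_on_subset[OF _ Y(2)])
qed

end
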